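(* Let \(\overline{D}\) be the closure of a bounded convex domain \(D\subset\mathbb{R}^n\) such that \(\partial D\) contains no line segments. Then no co-adapted coupling of reflected Brownian motions in \(\overline{D}\) is shy; that is, for every co-adapted coupling \((X,Y)\), every pair of starting points \(x_0\ne y_0\) in \(\overline{D}\) and every \(\varepsilon>0\), \[ \mathbb{P}\big(\|X_t-Y_t\|>\varepsilon\text{ for all }t\ge0 \,\big|\, X_0=x_0,Y_0=y_0\big)=0. \]
   Context: A reflected (reflecting) Brownian motion in \(\overline{D}\) started at \(x_0\) is the process \(X\) in \(\overline{D}\) solving \(X_t=x_0+B_t+\int_0^t\nu(X_s)\,dL^X_s\), where \(B\) is a standard \(n\)-dimensional Brownian motion, \(\nu\) is an inward-pointing unit normal vector field on \(\partial D\), and \(L^X\) is the minimal non-decreasing boundary local time keeping \(X\) in \(\overline{D}\) (unique solutions exist for bounded convex domains). A coupling is a family of processes \((X,Y)\) on \(\overline{D}^2\), one for each pair of starting points, with \(X\) and \(Y\) each separately reflected Brownian motions sharing the transition semigroup \(P^z_t\); it is co-adapted if for all \(s,t\ge0\), \(z\), measurable \(A\): \(\mathbb{P}(X_{s+t}\in A\mid X_s=z, X_u,Y_u:u\le s)=P^z_t(A)\) and \(\mathbb{P}(Y_{s+t}\in A\mid Y_s=z, X_u,Y_u:u\le s)=P^z_t(A)\). A coupling is shy if there exist starting points \(x_0\ne y_0\) and \(\varepsilon>0\) with \(\mathbb{P}(\|X_t-Y_t\|>\varepsilon\text{ for all }t\mid X_0=x_0,Y_0=y_0)>0\). *)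

theory Defs
  imports "HOL-Probability.Probability"
begin

text \<open>Standard n-dimensional Brownian motion (n = CARD('n)) on a probability space M,
  time parameter t \<ge> 0 (values for t < 0 are irrelevant).\<close>
definition brownian_motion :: "'w measure \<Rightarrow> (real \<Rightarrow> 'w \<Rightarrow> real^'n) \<Rightarrow> bool" where
  "brownian_motion M B \<longleftrightarrow>
     prob_space M \<and>
     (\<forall>t. B t \<in> borel_measurable M) \<and>
     (AE \<omega> in M. B 0 \<omega> = 0 \<and> continuous_on {0..} (\<lambda>t. B t \<omega>)) \<and>
     (\<forall>s t. 0 \<le> s \<and> s < t \<longrightarrow>
        prob_space.indep_vars M (\<lambda>_. borel) (\<lambda>i \<omega>. (B t \<omega> - B s \<omega>) $ i) UNIV \<and>
        (\<forall>i. distributed M lborel (\<lambda>\<omega>. (B t \<omega> - B s \<omega>) $ i)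
                (normal_density 0 (sqrt (t - s))))) \<and>
     (\<forall>(ts :: nat \<Rightarrow> real) k. 0 \<le> ts 0 \<and> (\<forall>j<k. ts j < ts (Suc j)) \<longrightarrow>
        prob_space.indep_vars M (\<lambda>_. borel) (\<lambda>j \<omega>. B (ts (Suc j)) \<omega> - B (ts j) \<omega>) {..<k})"

definition stieltjes :: "(real \<Rightarrow> real) \<Rightarrow> real measure" where
  "stieltjes L = interval_measure (\<lambda>t. L (max 0 t))"

text \<open>Reflected Brownian motion in closure D started at x0, with inward normal field \<nu>:
  X_t = x0 + B_t + \<integral>_0^t \<nu>(X_s) dL_s, L non-decreasing continuous, L_0 = 0,
  increasing only when X is on the boundary.\<close>
definition reflected_bm ::
  "(real^'n) set \<Rightarrow> (real^'n \<Rightarrow> real^'n) \<Rightarrow> 'w measure \<Rightarrow> real^'n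
     \<Rightarrow> (real \<Rightarrow> 'w \<Rightarrow> real^'n) \<Rightarrow> bool" where
  "reflected_bm D \<nu> M x0 X \<longleftrightarrow>
     (\<forall>t. X t \<in> borel_measurable M) \<and>
     (\<exists>B (L :: real \<Rightarrow> 'w \<Rightarrow> real).
        brownian_motion M B \<and>
        (\<forall>t. L t \<in> borel_measurable M) \<and>
        (AE \<omega> in M.
           L 0 \<omega> = 0 \<and>
           mono_on {0..} (\<lambda>t. L t \<omega>) \<and>
           continuous_on {0..} (\<lambda>t. L t \<omega>) \<and>
           (\<forall>t\<ge>0. X t \<omega> \<in> closure D) \<and>
           (\<forall>t\<ge>0. X t \<omega> = x0 + B t \<omega> +
               (LINT s:{0..t}|stieltjes (\<lambda>r. L r \<omega>). \<nu> (X s \<omega>))) \<and>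
           emeasure (stieltjes (\<lambda>r. L r \<omega>)) {s. 0 \<le> s \<and> X s \<omega> \<in> D} = 0))"

definition past :: "'w measure \<Rightarrow> (real \<Rightarrow> 'w \<Rightarrow> 'a::topological_space)
     \<Rightarrow> (real \<Rightarrow> 'w \<Rightarrow> 'a) \<Rightarrow> real \<Rightarrow> 'w measure" where
  "past M X Y s = sigma (space M)
     {(\<lambda>\<omega>. (X u \<omega>, Y u \<omega>)) -` A \<inter> space M | u A. 0 \<le> u \<and> u \<le> s \<and> A \<in> sets borel}"

definition co_adapted :: "'w measure \<Rightarrow> (real \<Rightarrow> 'w \<Rightarrow> real^'n) \<Rightarrow> (real \<Rightarrow> 'w \<Rightarrow> real^'n)
     \<Rightarrow> (real^'n \<Rightarrow> real \<Rightarrow> (real^'n) measure) \<Rightarrow> bool" where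
  "co_adapted M X Y P \<longleftrightarrow>
     (\<forall>s t A. 0 \<le> s \<and> 0 \<le> t \<and> A \<in> sets borel \<longrightarrow>
        (AE \<omega> in M. real_cond_exp M (past M X Y s)
            (indicator {\<eta> \<in> space M. X (s + t) \<eta> \<in> A}) \<omega> = measure (P (X s \<omega>) t) A) \<and>
        (AE \<omega> in M. real_cond_exp M (past M X Y s)
            (indicator {\<eta> \<in> space M. Y (s + t) \<eta> \<in> A}) \<omega> = measure (P (Y s \<omega>) t) A))"

end

theory Submission
  imports Defs
begin

text \<open>Fix a small \<open>\<eta> > 0\<close>, put \<open>w = x - (1 + \<eta>) y\<close> and \<open>\<Phi>(x, y) = exp (- \<theta> |w|\<^sup>2 / 2)\<close>. Under any coupling with
  contraction correlation \<open>J\<close>, the leading term (of order \<open>\<theta>\<^sup>2\<close>) of the generator applied to \<open>\<Phi>\<close> is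
  \<open>\<Phi> \<theta>\<^sup>2 / 2\<close> times the square of the norm of \<open>w - (1 + \<eta>) J w\<close> up to a nonnegative term, hence at least
  \<open>\<Phi> \<theta>\<^sup>2 \<eta>\<^sup>2 |w|\<^sup>2 / 2\<close>: the two gradients of \<open>|w|\<^sup>2\<close> have different lengths and cannot cancel. As the boundary
  contains no segments, reflection at distance at least \<open>\<epsilon>\<close> from the other particle strictly decreases \<open>|w|\<close>,
  so it increases \<open>\<Phi>\<close>. Thus for large \<open>\<theta>\<close> the bounded process \<open>\<Phi>(X, Y)\<close> has a uniformly positive drift
  while \<open>|X - Y| > \<epsilon>\<close>, which cannot go on forever.

  Stochastic calculus is avoided by working on a time grid of fixed small step \<open>h\<close>. A cubic lower bound for
  \<open>exp\<close> together with
  \<open>(w \<bullet> (a - (1 + \<eta>) b))\<^sup>2 \<ge> - \<eta> (w \<bullet> a)\<^sup>2 + \<eta> (1 + \<eta>) (w \<bullet> b)\<^sup>2\<close>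
  separates the increments \<open>a\<close> of \<open>X\<close> and \<open>b\<close> of \<open>Y\<close>, so that only their individual conditional laws matter,
  and these are known from co-adaptedness. For one reflected Brownian motion, the boundary push \<open>k\<close> in a short
  time is controlled pathwise: if the driving path stays within \<open>\<delta>\<close>, then \<open>|k| = O(\<delta>)\<close>, and
  a linear functional that is at least \<open>c\<close> on nearby normals is at least \<open>c |k|\<close> at \<open>k\<close>. This absorbs all
  error terms that involve the push.\<close>

section \<open>Paths of convex Skorokhod problems\<close>

text \<open>Compactness turns strict positivity into a uniform bound. If a supporting unit normal at
  \<open>u\<close> were orthogonal to \<open>y - u\<close>, the whole segment from \<open>u\<close>
  to \<open>y\<close> would lie in the supporting hyperplane and in the closure, hence in the
  frontier, against \<open>nosegs\<close>.\<close>

lemma strict_inward_normal: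
  fixes D :: "'a::euclidean_space set"
  assumes "open D" "bounded D" "convex D"
    and nosegs: "\<forall>a b. a \<noteq> b \<longrightarrow> \<not> closed_segment a b \<subseteq> frontier D"
    and nu: "\<forall>x\<in>frontier D. norm (\<nu> x) = 1 \<and> (\<forall>y\<in>closure D. 0 \<le> (y - x) \<bullet> \<nu> x)"
    and "e > 0"
  obtains c where "c > 0"
    "\<And>u y. \<lbrakk>u \<in> frontier D; y \<in> closure D; e \<le> norm (u - y)\<rbrakk> \<Longrightarrow> c \<le> (y - u) \<bullet> \<nu> u"
proof -
  \<comment> \<open>Since \<nu> need not be continuous, its graph need not be closed. The minimum is
    therefore taken over all supporting unit normals at \<open>u\<close>, which gives a closed set
    of triples.\<close>
  define T where "T = (frontier D \<times> closure D \<times> sphere 0 1) \<inter> {p. e \<le> norm (fst p - fst (snd p))}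
     \<inter> (\<Inter>w\<in>closure D. {p. 0 \<le> (w - fst p) \<bullet> snd (snd p)})"
  define \<phi> :: "'a \<times> 'a \<times> 'a \<Rightarrow> real" where "\<phi> = (\<lambda>p. (fst (snd p) - fst p) \<bullet> snd (snd p))"
  have "compact (frontier D \<times> closure D \<times> sphere (0::'a) 1)"
    using \<open>bounded D\<close> by (intro compact_Times) (auto simp: compact_frontier_bounded)
  moreover have "closed {p::'a\<times>'a\<times>'a. e \<le> norm (fst p - fst (snd p))}"
    by (intro closed_Collect_le continuous_intros)
  moreover have "closed (\<Inter>w\<in>closure D. {p::'a\<times>'a\<times>'a. 0 \<le> (w - fst p) \<bullet> snd (snd p)})"
    by (intro closed_INT ballI closed_Collect_le continuous_intros)
  ultimately have "compact T"
    unfolding T_def by (intro compact_Int_closed)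
  have pos: "0 < \<phi> p" if "p \<in> T" for p
  proof (rule ccontr)
    assume neg: "\<not> 0 < \<phi> p"
    obtain u y n where p: "p = (u, y, n)" by (cases p)
    have u: "u \<in> frontier D" and y: "y \<in> closure D" and n: "norm n = 1" and uy: "e \<le> norm (u - y)"
      and sup: "\<And>w. w \<in> closure D \<Longrightarrow> 0 \<le> (w - u) \<bullet> n"
      using that unfolding T_def p by auto
    have z: "(y - u) \<bullet> n = 0"
      using neg sup[OF y] unfolding p \<phi>_def by simp
    have "closed_segment u y \<subseteq> frontier D"
    proof
      fix w assume w: "w \<in> closed_segment u y"
      then have wc: "w \<in> closure D"
        using closed_segment_subset[OF _ y convex_closure[OF \<open>convex D\<close>], of u] u by (auto simp: frontier_def)
      obtain t where "w = (1 - t) *\<^sub>R u + t *\<^sub>R y" using w by (auto simp: in_segment)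
      then have "w - u = t *\<^sub>R (y - u)" by (simp add: algebra_simps)
      then have wz: "(w - u) \<bullet> n = 0" using z by simp
      \<comment> \<open>From a point of the open set \<open>D\<close> one could step by
        \<open>r/2\<close> against \<open>n\<close> inside \<open>D\<close> and violate the
        supporting inequality.\<close>
      have "w \<notin> D"
      proof
        assume "w \<in> D"
        then obtain r where r: "r > 0" "ball w r \<subseteq> D" using \<open>open D\<close> open_contains_ball by blast
        have "w - (r/2) *\<^sub>R n \<in> ball w r" using r n by (simp add: dist_norm)
        then have "w - (r/2) *\<^sub>R n \<in> closure D" using r closure_subset by blast
        from sup[OF this] have "0 \<le> (w - u) \<bullet> n - (r/2) * (n \<bullet> n)" by (simp add: inner_diff_left algebra_simps)
        then show False using wz n r by (simp add: dot_square_norm)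
      qed
      then show "w \<in> frontier D" using wc \<open>open D\<close> by (simp add: frontier_def interior_open)
    qed
    moreover have "u \<noteq> y" using uy \<open>e > 0\<close> by auto
    ultimately show False using nosegs by blast
  qed
  have mem: "(u, y, \<nu> u) \<in> T" if "u \<in> frontier D" "y \<in> closure D" "e \<le> norm (u - y)" for u y
    using that nu unfolding T_def by auto
  show thesis
  proof (cases "T = {}")
    case True
    show thesis by (rule that[of 1]) (use mem True in auto)
  next
    case False
    have "continuous_on T \<phi>" unfolding \<phi>_def by (intro continuous_intros)
    from continuous_attains_inf[OF \<open>compact T\<close> False this]
    obtain q where q: "q \<in> T" "\<And>p. p \<in> T \<Longrightarrow> \<phi> q \<le> \<phi> p" by auto
    show thesis
    proof (rule that[of "\<phi> q"])
      show "0 < \<phi> q" using pos q by auto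
      show "\<phi> q \<le> (y - u) \<bullet> \<nu> u" if "u \<in> frontier D" "y \<in> closure D" "e \<le> norm (u - y)" for u y
        using q(2)[OF mem[OF that]] by (simp add: \<phi>_def)
    qed
  qed
qed

section \<open>Integrals against the boundary local time\<close>

text \<open>This makes the boundary push measurable in time before its integrand is known to be so.
  The times \<open>t\<close> with \<open>g\<close> integrable on \<open>{a..t}\<close> form a
  down-closed set. Up to any such time the truncated integrand is measurable and measurability of
  parameter integrals applies; beyond all of them the integral has its default value.\<close>

lemma borel_measurable_set_integral_upper_limit:
  fixes g :: "real \<Rightarrow> 'a::euclidean_space"
  assumes "sigma_finite_measure \<mu>" and sets[measurable_cong]: "sets \<mu> = sets borel"
  shows "(\<lambda>t. LINT s:{a..t}|\<mu>. g s) \<in> borel_measurable borel"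
proof -
  interpret sigma_finite_measure \<mu> by fact
  define I where "I = {T. set_integrable \<mu> {a..T} g}"
  have sub: "t \<in> I" if "T \<in> I" "t \<le> T" for t T
    using that unfolding I_def by (auto intro: set_integrable_subset simp: sets)
  \<comment> \<open>A countable cofinal subset of \<open>I\<close>: its rationals suffice except for
    a possible greatest element, which is added.\<close>
  define S where "S = (I \<inter> \<rat>) \<union> {T\<in>I. \<forall>t\<in>I. t \<le> T}"
  have "{T\<in>I. \<forall>t\<in>I. t \<le> T} = {} \<or> (\<exists>T. {T\<in>I. \<forall>t\<in>I. t \<le> T} = {T})"
  proof (cases "\<exists>T\<in>I. \<forall>t\<in>I. t \<le> T")
    case True
    then obtain T where "T \<in> I" "\<forall>t\<in>I. t \<le> T" by blast
    then have "{T\<in>I. \<forall>t\<in>I. t \<le> T} = {T}" by (auto intro: antisym)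
    then show ?thesis by blast
  qed auto
  then have "countable {T\<in>I. \<forall>t\<in>I. t \<le> T}" by (elim disjE exE) (simp_all only: countable_empty countable_insert)
  then have "countable S"
    unfolding S_def using countable_rat by (simp only: countable_Un_iff) (auto intro: countable_Int2)
  have cover: "\<exists>T\<in>S. t \<le> T" if "t \<in> I" for t
  proof (cases "\<forall>s\<in>I. s \<le> t")
    case False
    then obtain s where "s \<in> I" "t < s" by auto
    then obtain q where "q \<in> \<rat>" "t < q" "q < s" using Rats_dense_in_real by blast
    then show ?thesis using sub[OF \<open>s \<in> I\<close>, of q] unfolding S_def by (intro bexI[of _ q]) auto
  qed (use that in \<open>auto simp: S_def\<close>)
  define C where "C = insert (- (\<Union>T\<in>S. {..T})) ((\<lambda>T. {..T}) ` S)"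
  have U: "- (\<Union>T\<in>S. {..T}) \<in> sets borel"
    using \<open>countable S\<close> by (intro borel_comp sets.countable_UN') auto
  show ?thesis
  proof (rule measurable_piecewise_restrict[where C = C])
    show "countable C" unfolding C_def using \<open>countable S\<close> by auto
    show "space borel \<subseteq> \<Union>C" unfolding C_def by auto
    show "\<Omega> \<inter> space borel \<in> sets borel" if \<Omega>: "\<Omega> \<in> C" for \<Omega>
    proof -
      consider "\<Omega> = - (\<Union>T\<in>S. {..T})" | T where "\<Omega> = {..T}" using \<Omega> unfolding C_def by blast
      then have "\<Omega> \<in> sets borel"
      proof cases
        case 1
        show ?thesis unfolding 1 by (rule U)
      next
        case 2
        show ?thesis unfolding 2 by (rule atMost_borel)
      qed
      then show ?thesis by (simp only: space_borel Int_UNIV_right)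
    qed
    show "(\<lambda>t. LINT s:{a..t}|\<mu>. g s) \<in> borel_measurable (restrict_space borel \<Omega>)" if \<Omega>: "\<Omega> \<in> C" for \<Omega>
    proof -
      consider "\<Omega> = - (\<Union>T\<in>S. {..T})" | T where "T \<in> S" "\<Omega> = {..T}" using \<Omega> unfolding C_def by blast
      then show ?thesis
      proof cases
        case 1
        \<comment> \<open>The Bochner integral of a non-integrable function is 0 by
          convention.\<close>
        have "(LINT s:{a..t}|\<mu>. g s) = 0" if "t \<in> \<Omega>" for t
        proof -
          have "t \<notin> I" using that cover[of t] unfolding 1 by fastforce
          then show ?thesis unfolding I_def set_lebesgue_integral_def set_integrable_def
            by (simp add: not_integrable_integral_eq)
        qed
        then show ?thesis
          by (subst measurable_cong[where g = "\<lambda>_. 0"]) (auto simp: space_restrict_space)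
      next
        case 2
        have "T \<in> I" using 2 by (auto simp: S_def)
        \<comment> \<open>Integrability includes measurability, so \<open>g\<close> truncated at
          \<open>T\<close> is measurable.\<close>
        then have [measurable]: "(\<lambda>s. indicator {a..T} s *\<^sub>R g s) \<in> borel_measurable \<mu>"
          unfolding I_def set_integrable_def by (auto dest: borel_measurable_integrable)
        have eq: "(LINT s:{a..t}|\<mu>. g s)
            = (LINT s|\<mu>. (if a \<le> s \<and> s \<le> t then 1 else 0) *\<^sub>R (indicator {a..T} s *\<^sub>R g s))" if "t \<in> \<Omega>" for t
          unfolding set_lebesgue_integral_def
          by (rule Bochner_Integration.integral_cong) (use that 2 in \<open>auto simp: indicator_def\<close>)
        have "(\<lambda>t. LINT s|\<mu>. (if a \<le> s \<and> s \<le> t then 1 else 0) *\<^sub>R (indicator {a..T} s *\<^sub>R g s)) \<in> borel_measurable borel"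
          by measurable
        then show ?thesis
          by (subst measurable_cong[OF eq]) (auto simp: space_restrict_space intro: measurable_restrict_space1)
      qed
    qed
  qed
qed

text \<open>Off the diagonal, splitting the double integral into \<open>u < s\<close> and \<open>s < u\<close> gives equality;
  atoms on the diagonal only help.\<close>

lemma inner_integral_square_le:
  fixes G :: "real \<Rightarrow> 'a::euclidean_space"
  assumes "finite_measure \<mu>" and sets[measurable_cong]: "sets \<mu> = sets borel"
    and G[measurable]: "G \<in> borel_measurable borel" and bd: "\<And>s. norm (G s) \<le> 1"
  shows "(\<integral>s. G s \<partial>\<mu>) \<bullet> (\<integral>s. G s \<partial>\<mu>)
    \<le> 2 * (\<integral>s. (\<integral>u. indicator {..s} u *\<^sub>R G u \<partial>\<mu>) \<bullet> G s \<partial>\<mu>)"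
proof -
  interpret finite_measure \<mu> by fact
  interpret pair: pair_sigma_finite \<mu> \<mu> ..
  interpret pairf: finite_measure "\<mu> \<Otimes>\<^sub>M \<mu>"
    by (rule finite_measure_pair_measure) (rule assms(1))+
  have intG: "integrable \<mu> G" using bd by (intro integrable_const_bound[where B = 1]) auto
  have intiG: "integrable \<mu> (\<lambda>u. indicator {..s} u *\<^sub>R G u)" for s
    using bd by (intro integrable_const_bound[where B = 1]) (auto simp: indicator_def)
  define f :: "real \<Rightarrow> real \<Rightarrow> real" where "f u s = (if u \<le> s then G u \<bullet> G s else 0)" for u s
  have bdi: "\<bar>G u \<bullet> G s\<bar> \<le> 1" for u s
    using Cauchy_Schwarz_ineq2[of "G u" "G s"] mult_mono[OF bd[of u] bd[of s]] by auto
  have bdf: "\<bar>f u s\<bar> \<le> 1" for u s using bdi unfolding f_def by auto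
  have f[measurable]: "(\<lambda>(u, s). f u s) \<in> borel_measurable (\<mu> \<Otimes>\<^sub>M \<mu>)"
    unfolding f_def by measurable
  have f'[measurable]: "(\<lambda>(u, s). f s u) \<in> borel_measurable (\<mu> \<Otimes>\<^sub>M \<mu>)"
    unfolding f_def by measurable
  have intf: "integrable (\<mu> \<Otimes>\<^sub>M \<mu>) (\<lambda>(u, s). f u s)"
    using bdf by (intro pairf.integrable_const_bound[where B = 1]) auto
  have intf': "integrable (\<mu> \<Otimes>\<^sub>M \<mu>) (\<lambda>(u, s). f s u)"
    using bdf by (intro pairf.integrable_const_bound[where B = 1]) auto
  have in1: "integrable \<mu> (\<lambda>u. f u s)" "integrable \<mu> (\<lambda>u. f s u)" for s
    using bdf unfolding f_def by (intro integrable_const_bound[where B = 1]; force)+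
  have out1: "integrable \<mu> (\<lambda>s. \<integral>u. f u s \<partial>\<mu>)" "integrable \<mu> (\<lambda>s. \<integral>u. f s u \<partial>\<mu>)"
    using pair.integrable_snd[of f] intf pair.integrable_fst[of f] by simp_all
  define J where "J = (\<integral>s. (\<integral>u. f u s \<partial>\<mu>) \<partial>\<mu>)"
  have J2: "J = (\<integral>s. (\<integral>u. f s u \<partial>\<mu>) \<partial>\<mu>)"
    unfolding J_def by (rule pair.Fubini_integral[OF intf])
  have "(\<integral>u. indicator {..s} u *\<^sub>R G u \<partial>\<mu>) \<bullet> G s = (\<integral>u. f u s \<partial>\<mu>)" for s
    by (subst integral_inner_left[symmetric, OF intiG])
       (auto simp: f_def intro!: Bochner_Integration.integral_cong)
  then have J1: "(\<integral>s. (\<integral>u. indicator {..s} u *\<^sub>R G u \<partial>\<mu>) \<bullet> G s \<partial>\<mu>) = J"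
    unfolding J_def by simp
  have "(\<integral>s. G s \<partial>\<mu>) \<bullet> (\<integral>s. G s \<partial>\<mu>) = (\<integral>s. (\<integral>u. G u \<bullet> G s \<partial>\<mu>) \<partial>\<mu>)"
    by (simp add: integral_inner_left intG integral_inner_right inner_commute)
  also have "\<dots> \<le> (\<integral>s. (\<integral>u. f u s + f s u \<partial>\<mu>) \<partial>\<mu>)"
  proof (rule integral_mono)
    show "integrable \<mu> (\<lambda>s. \<integral>u. G u \<bullet> G s \<partial>\<mu>)"
      using intG by (simp add: integral_inner_left)
    show "integrable \<mu> (\<lambda>s. \<integral>u. f u s + f s u \<partial>\<mu>)" using out1 by (simp add: in1)
    show "(\<integral>u. G u \<bullet> G s \<partial>\<mu>) \<le> (\<integral>u. f u s + f s u \<partial>\<mu>)" for s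
      using intG in1 by (intro integral_mono) (auto simp: f_def inner_commute)
  qed
  also have "\<dots> = J + J"
    using out1 in1 by (simp add: J_def[symmetric] J2[symmetric])
  finally show ?thesis using J1 by simp
qed

lemma stieltjes_basic:
  assumes L0: "L 0 = 0" and mono: "mono_on {0..} L" and cont: "continuous_on {0..} L"
  shows sets_stieltjes: "sets (stieltjes L) = sets borel"
    and sigma_finite_stieltjes: "sigma_finite_measure (stieltjes L)"
    and emeasure_stieltjes_Icc: "0 \<le> t \<Longrightarrow> emeasure (stieltjes L) {0..t} = ennreal (L t)"
proof -
  let ?F = "\<lambda>t. L (max 0 t)"
  have m: "?F x \<le> ?F y" if "x \<le> y" for x y using that by (intro mono_onD[OF mono]) auto
  have c: "continuous_on UNIV ?F"
    by (rule continuous_on_compose2[OF cont]) (auto intro!: continuous_intros)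
  have r: "continuous (at_right a) ?F" for a
    using c by (simp add: continuous_on_eq_continuous_at continuous_at_imp_continuous_at_within)
  show "sets (stieltjes L) = sets borel" by (simp add: stieltjes_def)
  show "sigma_finite_measure (stieltjes L)"
    unfolding stieltjes_def by (rule sigma_finite_interval_measure[OF m r])
  show "emeasure (stieltjes L) {0..t} = ennreal (L t)" if "0 \<le> t"
    unfolding stieltjes_def using emeasure_interval_measure_Icc[OF that m c] that L0 by simp
qed

section \<open>Pathwise bounds on the boundary push\<close>

text \<open>Let \<open>K\<close> be the push and \<open>J\<close> the integral of \<open>K\<close>
  against its own differential. The energy inequality gives
  \<open>(norm (K t))\<^sup>2 \<le> 2 * J\<close>. The supporting inequality tested at
  \<open>x\<close> gives \<open>J \<le> \<delta> * L t\<close>; tested on the ball around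
  \<open>z\<close> it bounds \<open>L t\<close> by a multiple of \<open>norm (K t)\<close>.
  Cancelling one factor \<open>norm (K t)\<close> yields the first claim. For the second, the path
  meets the frontier only within \<rho> of \<open>x\<close>, so \<open>l\<close> gains at least
  \<open>c\<close> per unit of local time, and \<open>norm (K h) \<le> L h\<close>.\<close>

lemma skorokhod_convex_path_bounds:
  fixes D :: "'a::euclidean_space set" and X B :: "real \<Rightarrow> 'a"
  assumes D: "open D" "closure D \<subseteq> cball 0 R" "ball z r \<subseteq> D" "0 < r"
    and nu[measurable]: "\<nu> \<in> borel_measurable borel"
    and nun: "\<forall>x\<in>frontier D. norm (\<nu> x) = 1 \<and> (\<forall>y\<in>closure D. 0 \<le> (y - x) \<bullet> \<nu> x)"
    and x: "x \<in> closure D"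
    and L: "L 0 = 0" "mono_on {0..} L" "continuous_on {0..} L"
    and B: "continuous_on {0..} B" and h: "0 \<le> h"
    and Xc: "\<And>t. 0 \<le> t \<Longrightarrow> X t \<in> closure D"
    and X: "\<And>t. 0 \<le> t \<Longrightarrow> X t = x + B t + (LINT s:{0..t}|stieltjes L. \<nu> (X s))"
    and null: "emeasure (stieltjes L) {s. 0 \<le> s \<and> X s \<in> D} = 0"
    and Bd: "\<And>s. \<lbrakk>0 \<le> s; s \<le> h\<rbrakk> \<Longrightarrow> norm (B s) \<le> \<delta>" and \<delta>: "\<delta> \<le> r / 2"
  shows "norm (X h - x - B h) \<le> 8 * R * \<delta> / r"
    and "\<And>l c \<rho>. \<lbrakk>\<And>u. \<lbrakk>u \<in> frontier D; norm (u - x) \<le> \<rho>\<rbrakk> \<Longrightarrow> c \<le> l \<bullet> \<nu> u; 0 \<le> c;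
      (1 + 8 * R / r) * \<delta> \<le> \<rho>\<rbrakk> \<Longrightarrow> c * norm (X h - x - B h) \<le> l \<bullet> (X h - x - B h)"
proof -
  define \<mu> where "\<mu> = stieltjes L"
  have sets[measurable_cong]: "sets \<mu> = sets borel" unfolding \<mu>_def by (rule sets_stieltjes[OF L])
  have em: "emeasure \<mu> {0..t} = ennreal (L t)" if "0 \<le> t" for t
    unfolding \<mu>_def by (rule emeasure_stieltjes_Icc[OF L that])
  define K where "K t = (LINT s:{0..t}|\<mu>. \<nu> (X s))" for t
  have [measurable]: "K \<in> borel_measurable borel"
    unfolding K_def
    by (rule borel_measurable_set_integral_upper_limit[OF _ sets]) (simp add: \<mu>_def sigma_finite_stieltjes[OF L])
  define B' where "B' t = B (max 0 t)" for t
  have "continuous_on UNIV B'"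
    unfolding B'_def by (rule continuous_on_compose2[OF B]) (auto intro!: continuous_intros)
  then have [measurable]: "B' \<in> borel_measurable borel" by (rule borel_measurable_continuous_onI)
  \<comment> \<open>Measurability in time is read off the Skorokhod equation: \<open>X'\<close> is
    built from the measurable \<open>B'\<close> and \<open>K\<close> and agrees with
    \<open>X\<close> at nonnegative times.\<close>
  define X' where "X' t = (if 0 \<le> t then x + B' t + K t else x)" for t
  have [measurable]: "X' \<in> borel_measurable borel" unfolding X'_def by measurable
  have X'X: "X' t = X t" if "0 \<le> t" for t
    using X[OF that] that unfolding X'_def B'_def K_def \<mu>_def by simp
  have front: "X s \<in> frontier D" if "0 \<le> s" "X s \<notin> D" for s
    using Xc[OF that(1)] that(2) \<open>open D\<close> by (simp add: frontier_def interior_open)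
  \<comment> \<open>\<open>\<nu>\<close> is arbitrary off the frontier, but the local time does not charge those times.\<close>
  have [measurable]: "D \<in> sets borel" using \<open>open D\<close> by simp
  define g where "g s = (if 0 \<le> s \<and> X' s \<notin> D then \<nu> (X' s) else 0)" for s
  have g[measurable]: "g \<in> borel_measurable borel" unfolding g_def by measurable
  have gcases: "g s = 0 \<or> 0 \<le> s \<and> X s \<in> frontier D \<and> g s = \<nu> (X s)" for s
    using X'X front unfolding g_def by metis
  have gn: "norm (g s) \<le> 1" for s using gcases[of s] nun by auto
  have "{s. 0 \<le> s \<and> X s \<in> D} = {s. 0 \<le> s \<and> X' s \<in> D}" using X'X by auto
  then have "emeasure \<mu> {s \<in> space \<mu>. 0 \<le> s \<and> X' s \<in> D} = 0"
    using null by (simp add: \<mu>_def stieltjes_def)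
  moreover have "{s \<in> space \<mu>. 0 \<le> s \<and> X' s \<in> D} \<in> sets \<mu>" by measurable
  ultimately have AEf: "AE s in \<mu>. \<not> (0 \<le> s \<and> X' s \<in> D)"
    by (subst AE_iff_null) (auto simp: null_sets_def)
  have AEg: "AE s in \<mu>. 0 \<le> s \<longrightarrow> g s = \<nu> (X s) \<and> X s \<in> frontier D"
    using AEf by eventually_elim (auto simp: g_def X'X front)
  \<comment> \<open>Restriction to \<open>{0..t}\<close> gives a finite measure of mass
    \<open>L t\<close>, as the energy inequality requires.\<close>
  define \<mu>t where "\<mu>t t = density \<mu> (\<lambda>s. ennreal (indicator {0..t} s))" for t
  have setst[measurable_cong]: "sets (\<mu>t t) = sets borel" for t unfolding \<mu>t_def by (simp add: sets)
  have emt: "emeasure (\<mu>t t) UNIV = ennreal (L t)" if "0 \<le> t" for t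
    unfolding \<mu>t_def using em[OF that] by (subst emeasure_density) (auto simp: sets ennreal_indicator)
  have fin: "finite_measure (\<mu>t t)" if "0 \<le> t" for t
  proof
    have "space (\<mu>t t) = UNIV" using sets_eq_imp_space_eq[OF setst[of t]] by simp
    then show "emeasure (\<mu>t t) (space (\<mu>t t)) \<noteq> \<infinity>" using emt[OF that] by simp
  qed
  have AEt: "AE s in \<mu>t t. 0 \<le> s \<and> s \<le> t \<and> g s = \<nu> (X s) \<and> X s \<in> frontier D" if "0 \<le> t" for t
    unfolding \<mu>t_def using AEg by (subst AE_density) (auto simp: indicator_def elim!: eventually_mono)
  have meast: "(\<integral>s. c \<partial>\<mu>t t) = L t * c" if "0 \<le> t" for t and c :: real
  proof -
    have "space (\<mu>t t) = UNIV" using sets_eq_imp_space_eq[OF setst[of t]] by simp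
    moreover have "0 \<le> L t" using mono_onD[OF L(2), of 0 t] L(1) that by auto
    ultimately show ?thesis using emt[OF that] by (simp add: measure_def)
  qed
  \<comment> \<open>A single measure \<open>\<mu>t t\<close> serves all earlier times
    \<open>s\<close>; this is the truncated inner integral of
    \<open>inner_integral_square_le\<close>.\<close>
  have Kg: "K s = (\<integral>u. indicator {..s} u *\<^sub>R g u \<partial>\<mu>t t)" if "0 \<le> s" "s \<le> t" for s t
  proof -
    have "(\<integral>u. indicator {..s} u *\<^sub>R g u \<partial>\<mu>t t) = (\<integral>u. indicator {0..t} u *\<^sub>R (indicator {..s} u *\<^sub>R g u) \<partial>\<mu>)"
      unfolding \<mu>t_def by (subst integral_density) (auto simp: sets)
    also have "\<dots> = (\<integral>u. indicator {0..s} u *\<^sub>R g u \<partial>\<mu>)"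
      using that by (intro Bochner_Integration.integral_cong) (auto simp: indicator_def)
    also have "\<dots> = (\<integral>u. indicator {0..s} u *\<^sub>R \<nu> (X' u) \<partial>\<mu>)"
    proof (rule integral_cong_AE)
      show "AE u in \<mu>. indicator {0..s} u *\<^sub>R g u = indicator {0..s} u *\<^sub>R \<nu> (X' u)"
        using AEf by eventually_elim (auto simp: g_def indicator_def)
    qed measurable
    also have "\<dots> = K s"
      unfolding K_def set_lebesgue_integral_def
      by (intro Bochner_Integration.integral_cong) (auto simp: indicator_def X'X)
    finally show ?thesis by simp
  qed
  have Kt: "K t = (\<integral>u. g u \<partial>\<mu>t t)" if "0 \<le> t" for t
  proof -
    have "K t = (\<integral>u. indicator {..t} u *\<^sub>R g u \<partial>\<mu>t t)" using Kg that by simp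
    also have "\<dots> = (\<integral>u. g u \<partial>\<mu>t t)"
    proof (rule integral_cong_AE)
      show "AE u in \<mu>t t. indicator {..t} u *\<^sub>R g u = g u"
        using AEt[OF that] by eventually_elim simp
    qed measurable
    finally show ?thesis .
  qed
  have inti: "integrable (\<mu>t t) (\<lambda>s. v \<bullet> g s)" "integrable (\<mu>t t) (\<lambda>s::real. c)" "integrable (\<mu>t t) g"
    if "0 \<le> t" for t v and c :: real
  proof -
    interpret finite_measure "\<mu>t t" by (rule fin[OF that])
    show 3: "integrable (\<mu>t t) g" using gn by (intro integrable_const_bound[where B = 1]) auto
    show "integrable (\<mu>t t) (\<lambda>s. v \<bullet> g s)" using 3 by simp
    show "integrable (\<mu>t t) (\<lambda>s::real. c)" by simp
  qed
  have Kn: "norm (K t) \<le> L t" if "0 \<le> t" for t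
  proof -
    have "norm (K t) \<le> (\<integral>u. norm (g u) \<partial>\<mu>t t)" unfolding Kt[OF that] by (rule integral_norm_bound)
    also have "\<dots> \<le> (\<integral>u. 1 \<partial>\<mu>t t)"
      using inti[OF that] gn by (intro integral_mono) auto
    finally show ?thesis unfolding meast[OF that] by simp
  qed
  have X_eq: "X t = x + B t + K t" if "0 \<le> t" for t using X[OF that] by (simp add: K_def \<mu>_def)
  have "0 \<le> R"
    using D(2) x by (auto simp: subset_iff intro: order_trans[OF norm_ge_zero])
  have zc: "z \<in> closure D" using D(3,4) closure_subset[of D] centre_in_ball[of z r] by blast
  have bound: "norm (K t) \<le> 8 * R * \<delta> / r" if t: "0 \<le> t" "t \<le> h" for t
  proof -
    interpret finite_measure "\<mu>t t" by (rule fin[OF t(1)])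
    define J where "J = (\<integral>s. K s \<bullet> g s \<partial>\<mu>t t)"
    have "(norm (K t))\<^sup>2 \<le> 2 * (\<integral>s. (\<integral>u. indicator {..s} u *\<^sub>R g u \<partial>\<mu>t t) \<bullet> g s \<partial>\<mu>t t)"
      using inner_integral_square_le[OF fin[OF t(1)] setst g gn] Kt[OF t(1)] by (simp add: power2_norm_eq_inner)
    also have "(\<integral>s. (\<integral>u. indicator {..s} u *\<^sub>R g u \<partial>\<mu>t t) \<bullet> g s \<partial>\<mu>t t) = J"
    proof -
      interpret pm: sigma_finite_measure "\<mu>t t" ..
      have [measurable]: "(\<lambda>s. \<integral>u. indicator {..s} u *\<^sub>R g u \<partial>\<mu>t t) \<in> borel_measurable (\<mu>t t)"
      proof -
        have [measurable_cong]: "sets (\<mu>t t) = sets borel" by (rule setst)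
        have "(\<lambda>s. \<integral>u. (if u \<le> s then 1 else 0) *\<^sub>R g u \<partial>\<mu>t t) \<in> borel_measurable (\<mu>t t)"
          by measurable
        then show ?thesis by (simp add: indicator_def)
      qed
      have [measurable]: "K \<in> borel_measurable (\<mu>t t)" by measurable
      show ?thesis unfolding J_def
      proof (rule integral_cong_AE)
        show "AE s in \<mu>t t. (\<integral>u. indicator {..s} u *\<^sub>R g u \<partial>\<mu>t t) \<bullet> g s = K s \<bullet> g s"
          using AEt[OF t(1)] by eventually_elim (use Kg[of _ t] in auto)
      qed measurable
    qed
    finally have K2: "(norm (K t))\<^sup>2 \<le> 2 * J" .
    then have J0: "0 \<le> J" using zero_le_power2[of "norm (K t)"] by linarith
    have Lt: "norm (K s) \<le> L t" if "0 \<le> s" "s \<le> t" for s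
      using Kn[OF that(1)] mono_onD[OF L(2), of s t] that by auto
    have intK: "integrable (\<mu>t t) (\<lambda>s. K s \<bullet> g s)"
    proof (rule integrable_const_bound[where B = "L t"])
      show "AE s in \<mu>t t. norm (K s \<bullet> g s) \<le> L t"
        using AEt[OF t(1)]
      proof eventually_elim
        case (elim s)
        have "\<bar>K s \<bullet> g s\<bar> \<le> norm (K s) * norm (g s)" by (rule Cauchy_Schwarz_ineq2)
        also have "\<dots> \<le> L t * 1" using Lt[of s] elim gn[of s] by (intro mult_mono) (auto intro: order_trans[OF norm_ge_zero])
        finally show ?case by simp
      qed
    qed measurable
    have J1: "J \<le> L t * \<delta>"
    proof -
      have "J \<le> (\<integral>s. \<delta> \<partial>\<mu>t t)" unfolding J_def
      proof (rule integral_mono_AE[OF intK inti(2)[OF t(1)]])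
        show "AE s in \<mu>t t. K s \<bullet> g s \<le> \<delta>"
          using AEt[OF t(1)]
        proof eventually_elim
          case (elim s)
          have "0 \<le> (x - X s) \<bullet> g s" using elim nun x by auto
          then have "K s \<bullet> g s \<le> - (B s \<bullet> g s)" using X_eq[of s] elim by (simp add: inner_diff_left inner_add_left)
          also have "\<dots> \<le> norm (B s) * norm (g s)" using Cauchy_Schwarz_ineq2[of "B s" "g s"] by linarith
          also have "\<dots> \<le> \<delta> * 1" using Bd[of s] elim t gn[of s] by (intro mult_mono) (auto intro: order_trans[OF norm_ge_zero])
          finally show ?case by simp
        qed
      qed
      then show ?thesis unfolding meast[OF t(1)] .
    qed
    have J2: "r * L t \<le> (z - x) \<bullet> K t + \<delta> * L t - J"
    proof -
      have "(\<integral>s. r \<partial>\<mu>t t) \<le> (\<integral>s. (z - x) \<bullet> g s + \<delta> - K s \<bullet> g s \<partial>\<mu>t t)"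
      proof (rule integral_mono_AE)
        show "AE s in \<mu>t t. r \<le> (z - x) \<bullet> g s + \<delta> - K s \<bullet> g s"
          using AEt[OF t(1)]
        proof eventually_elim
          case (elim s)
          have n1: "norm (g s) = 1" using elim nun by auto
          \<comment> \<open>The point of the closed ball lying farthest against the normal; testing
            the supporting inequality there gains the extra \<open>r\<close>.\<close>
          have zr: "z - r *\<^sub>R g s \<in> closure D"
          proof -
            have "z - r *\<^sub>R g s \<in> cball z r" using n1 D(4) by (simp add: dist_norm)
            then show ?thesis using closure_mono[OF D(3)] D(4) by auto
          qed
          then have "0 \<le> (z - r *\<^sub>R g s - X s) \<bullet> g s" using elim nun by auto
          then have "r \<le> (z - X s) \<bullet> g s"
            using n1 by (simp add: inner_diff_left dot_square_norm)
          moreover have "- (B s \<bullet> g s) \<le> \<delta>"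
            using Cauchy_Schwarz_ineq2[of "B s" "g s"] n1 Bd[of s] elim t by auto
          ultimately show ?case using X_eq[of s] elim by (simp add: inner_diff_left inner_add_left)
        qed
      qed (use inti[OF t(1)] intK in auto)
      also have "\<dots> = (z - x) \<bullet> K t + \<delta> * L t - J"
      proof -
        have "(\<integral>s. (z - x) \<bullet> g s + \<delta> - K s \<bullet> g s \<partial>\<mu>t t) = (\<integral>s. (z - x) \<bullet> g s \<partial>\<mu>t t) + (\<integral>s. \<delta> \<partial>\<mu>t t) - J"
          unfolding J_def using inti[OF t(1)] intK by simp
        then show ?thesis unfolding meast[OF t(1)] using inti[OF t(1)] by (simp add: Kt[OF t(1)] mult.commute)
      qed
      finally show ?thesis unfolding meast[OF t(1)] by (simp add: mult.commute)
    qed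
    have "(z - x) \<bullet> K t \<le> norm (z - x) * norm (K t)" using Cauchy_Schwarz_ineq2[of "z - x" "K t"] by linarith
    also have "\<dots> \<le> (2 * R) * norm (K t)"
    proof (rule mult_right_mono)
      have "norm z \<le> R" "norm x \<le> R" using zc x D(2) by auto
      then show "norm (z - x) \<le> 2 * R" using norm_triangle_ineq4[of z x] by linarith
    qed simp
    finally have zx: "(z - x) \<bullet> K t \<le> 2 * R * norm (K t)" .
    have L0: "0 \<le> L t" using Kn[OF t(1)] norm_ge_zero order_trans by blast
    have "\<delta> * L t \<le> r / 2 * L t" using \<delta> L0 by (rule mult_right_mono)
    then have "r / 2 * L t \<le> 2 * R * norm (K t)" using J2 J0 zx by linarith
    then have LK: "L t \<le> 4 * R / r * norm (K t)" using D(4) by (simp add: field_simps)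
    have "0 \<le> \<delta>" using Bd[of 0] h norm_ge_zero[of "B 0"] by linarith
    have "norm (K t) * norm (K t) \<le> 2 * (\<delta> * (4 * R / r * norm (K t)))"
      using K2 J1 mult_left_mono[OF LK \<open>0 \<le> \<delta>\<close>] unfolding power2_eq_square mult.commute[of \<delta> "L t"] by linarith
    then have "norm (K t) * norm (K t) \<le> (8 * R * \<delta> / r) * norm (K t)" by (simp add: field_simps)
    then show ?thesis
      using D(4) \<open>0 \<le> R\<close> \<open>0 \<le> \<delta>\<close> by (cases "K t = 0") (auto dest: mult_right_le_imp_le simp del: times_divide_eq_left)
  qed
  have Keq: "X h - x - B h = K h" using X_eq[OF h] by simp
  show "norm (X h - x - B h) \<le> 8 * R * \<delta> / r" unfolding Keq using bound h by simp
  fix l c \<rho>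
  assume l: "\<And>u. \<lbrakk>u \<in> frontier D; norm (u - x) \<le> \<rho>\<rbrakk> \<Longrightarrow> c \<le> l \<bullet> \<nu> u" and c: "0 \<le> c"
    and \<rho>: "(1 + 8 * R / r) * \<delta> \<le> \<rho>"
  have "L h * c = (\<integral>s. c \<partial>\<mu>t h)" unfolding meast[OF h] ..
  also have "\<dots> \<le> (\<integral>s. l \<bullet> g s \<partial>\<mu>t h)"
  proof (rule integral_mono_AE)
    show "AE s in \<mu>t h. c \<le> l \<bullet> g s"
      using AEt[OF h]
    proof eventually_elim
      case (elim s)
      \<comment> \<open>The first claim at time \<open>s\<close> keeps every visited frontier point
        within \<rho> of \<open>x\<close>, where the hypothesis on \<open>l\<close> applies.\<close>
      have "norm (X s - x) \<le> norm (B s) + norm (K s)" using X_eq[of s] elim norm_triangle_ineq[of "B s" "K s"] by simp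
      also have "\<dots> \<le> \<delta> + 8 * R * \<delta> / r" using Bd[of s] bound[of s] elim by auto
      also have "\<dots> \<le> \<rho>" using \<rho> by (simp add: algebra_simps)
      finally show ?case using l elim by simp
    qed
  qed (use inti[OF h] in auto)
  also have "\<dots> = l \<bullet> K h" using inti[OF h] Kt[OF h] by simp
  finally show "c * norm (X h - x - B h) \<le> l \<bullet> (X h - x - B h)"
    unfolding Keq using mult_left_mono[OF Kn[OF h] c] by (simp add: mult.commute)
qed

section \<open>Brownian increments\<close>

text \<open>The fourth moment feeds the maximal bound and the tail estimates; the exact first and
  second moments supply the drift. Independence and centering remove the mixed products of
  components.\<close>

lemma (in prob_space) indep_normal_vector_moments:
  fixes V :: "'a \<Rightarrow> real^'n" and \<sigma> :: real
  assumes ind: "indep_vars (\<lambda>_. borel) (\<lambda>i \<omega>. V \<omega> $ i) UNIV"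
    and dist: "\<And>i. distributed M lborel (\<lambda>\<omega>. V \<omega> $ i) (normal_density 0 \<sigma>)" and "0 < \<sigma>"
    and [measurable]: "V \<in> borel_measurable M"
  shows "integrable M (\<lambda>\<omega>. norm (V \<omega>) ^ 4)"
    and "expectation (\<lambda>\<omega>. norm (V \<omega>) ^ 4) \<le> 3 * (CARD('n))\<^sup>2 * \<sigma> ^ 4"
    and "integrable M (\<lambda>\<omega>. (norm (V \<omega>))\<^sup>2)"
    and "expectation (\<lambda>\<omega>. (norm (V \<omega>))\<^sup>2) = CARD('n) * \<sigma>\<^sup>2"
    and "integrable M V" and "expectation V = 0"
    and "integrable M (\<lambda>\<omega>. (m \<bullet> V \<omega>)\<^sup>2)"
    and "expectation (\<lambda>\<omega>. (m \<bullet> V \<omega>)\<^sup>2) = (norm m)\<^sup>2 * \<sigma>\<^sup>2"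
proof -
  have int: "integrable M (\<lambda>\<omega>. (V \<omega> $ i) ^ k)" for i k
    using distributed_integrable[OF dist[of i], of "\<lambda>x. x ^ k"] integrable_normal_moment[OF \<open>0 < \<sigma>\<close>, of 0 k] by simp
  have Ek: "expectation (\<lambda>\<omega>. (V \<omega> $ i) ^ k) = (\<integral>x. normal_density 0 \<sigma> x * x ^ k \<partial>lborel)" for i k
    using distributed_integral[OF dist[of i], of "\<lambda>x. x ^ k"] by simp
  have E4: "expectation (\<lambda>\<omega>. (V \<omega> $ i) ^ 4) = 3 * \<sigma> ^ 4" for i
    using integral_normal_moment_even[OF \<open>0 < \<sigma>\<close>, of 0 2] \<open>0 < \<sigma>\<close>
    unfolding Ek by (simp add: fact_numeral power_divide field_simps power2_eq_square eval_nat_numeral)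
  have E2: "expectation (\<lambda>\<omega>. (V \<omega> $ i)\<^sup>2) = \<sigma>\<^sup>2" for i
    using integral_normal_moment_even[OF \<open>0 < \<sigma>\<close>, of 0 1] \<open>0 < \<sigma>\<close>
    unfolding Ek by simp
  have E1: "expectation (\<lambda>\<omega>. V \<omega> $ i) = 0" for i
    using integral_normal_moment_odd[OF \<open>0 < \<sigma>\<close>, of 0 0] Ek[of i 1] by simp
  have int1: "integrable M (\<lambda>\<omega>. V \<omega> $ i)" for i using int[of i 1] by simp
  have cross: "integrable M (\<lambda>\<omega>. V \<omega> $ i * V \<omega> $ j) \<and>
      expectation (\<lambda>\<omega>. V \<omega> $ i * V \<omega> $ j) = (if i = j then \<sigma>\<^sup>2 else 0)" for i j
  proof (cases "i = j")
    case True
    then show ?thesis using int[of i 2] E2[of i] by (simp add: power2_eq_square)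
  next
    case False
    have ind2: "indep_vars (\<lambda>_. borel) (\<lambda>i \<omega>. V \<omega> $ i) {i, j}" by (rule indep_vars_subset[OF ind]) simp
    show ?thesis
      using indep_vars_lebesgue_integral[OF _ ind2 int1] indep_vars_integrable[OF _ ind2 int1] False E1 by simp
  qed
  have n2: "(norm v)\<^sup>2 = (\<Sum>i\<in>UNIV. (v $ i)\<^sup>2)" for v :: "real^'n"
    unfolding power2_norm_eq_inner inner_vec_def by (simp add: power2_eq_square)
  have n4: "norm v ^ 4 \<le> CARD('n) * (\<Sum>i\<in>UNIV. (v $ i) ^ 4)" for v :: "real^'n"
  proof -
    have "norm v ^ 4 = (\<Sum>i\<in>UNIV. (v $ i)\<^sup>2 * 1)\<^sup>2" unfolding mult_1_right n2[symmetric] by (simp flip: power_mult)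
    also have "\<dots> \<le> (\<Sum>i\<in>UNIV. ((v $ i)\<^sup>2)\<^sup>2) * (\<Sum>i\<in>(UNIV::'n set). 1\<^sup>2)"
      by (rule Cauchy_Schwarz_ineq_sum)
    finally show ?thesis by (simp add: power_mult[symmetric] mult.commute)
  qed
  show i4: "integrable M (\<lambda>\<omega>. norm (V \<omega>) ^ 4)"
    by (rule Bochner_Integration.integrable_bound[where f = "\<lambda>\<omega>. CARD('n) * (\<Sum>i\<in>UNIV. (V \<omega> $ i) ^ 4)"])
       (use n4 int in \<open>auto intro!: AE_I2 order_trans[OF n4]\<close>)
  have "expectation (\<lambda>\<omega>. norm (V \<omega>) ^ 4) \<le> expectation (\<lambda>\<omega>. CARD('n) * (\<Sum>i\<in>UNIV. (V \<omega> $ i) ^ 4))"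
    using i4 int n4 by (intro integral_mono) auto
  also have "\<dots> = 3 * (CARD('n))\<^sup>2 * \<sigma> ^ 4" using int E4 by (simp add: power2_eq_square)
  finally show "expectation (\<lambda>\<omega>. norm (V \<omega>) ^ 4) \<le> 3 * (CARD('n))\<^sup>2 * \<sigma> ^ 4" .
  show "integrable M (\<lambda>\<omega>. (norm (V \<omega>))\<^sup>2)" unfolding n2 using int by auto
  show "expectation (\<lambda>\<omega>. (norm (V \<omega>))\<^sup>2) = CARD('n) * \<sigma>\<^sup>2" unfolding n2 using int E2 by simp
  show iV: "integrable M V"
  proof (rule Bochner_Integration.integrable_bound[where f = "\<lambda>\<omega>. 1 + norm (V \<omega>) ^ 4"])
    show "AE \<omega> in M. norm (V \<omega>) \<le> norm (1 + norm (V \<omega>) ^ 4)"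
    proof (rule AE_I2)
      fix \<omega>
      show "norm (V \<omega>) \<le> norm (1 + norm (V \<omega>) ^ 4)"
      proof (cases "norm (V \<omega>) \<le> 1")
        case True
        then show ?thesis by (simp add: add_increasing2)
      next
        case False
        then have "norm (V \<omega>) ^ 1 \<le> norm (V \<omega>) ^ 4" by (intro power_increasing) auto
        then show ?thesis by simp
      qed
    qed
  qed (use i4 in auto)
  show "expectation V = 0"
  proof (subst vec_eq_iff, intro allI)
    fix i
    have "expectation V $ i = expectation (\<lambda>\<omega>. V \<omega> $ i)"
      using integral_bounded_linear[OF bounded_linear_vec_nth iV, of i] by simp
    then show "expectation V $ i = (0::real^'n) $ i" using E1 by simp
  qed
  have mV: "(m \<bullet> V \<omega>)\<^sup>2 = (\<Sum>i\<in>UNIV. \<Sum>j\<in>UNIV. m $ i * m $ j * (V \<omega> $ i * V \<omega> $ j))" for \<omega>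
    by (simp add: power2_eq_square inner_vec_def sum_product algebra_simps)
  show "integrable M (\<lambda>\<omega>. (m \<bullet> V \<omega>)\<^sup>2)" unfolding mV using cross by auto
  have "expectation (\<lambda>\<omega>. (m \<bullet> V \<omega>)\<^sup>2) = (\<Sum>i\<in>UNIV. \<Sum>j\<in>UNIV. m $ i * m $ j * (if i = j then \<sigma>\<^sup>2 else 0))"
    unfolding mV using cross by simp
  also have "\<dots> = (norm m)\<^sup>2 * \<sigma>\<^sup>2"
    unfolding n2[of m] by (simp add: power2_eq_square sum_distrib_right if_distrib[of "(*) _"] sum.delta cong: if_cong)
  finally show "expectation (\<lambda>\<omega>. (m \<bullet> V \<omega>)\<^sup>2) = (norm m)\<^sup>2 * \<sigma>\<^sup>2" .
qed

section \<open>Chaining bound for the running maximum\<close>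

text \<open>A dyadic point is reached from 0 by at most one increment per level, and the allowed
  increments sum to at most \<delta>; continuity extends the bound to all times.\<close>

lemma norm_le_of_dyadic_increments:
  fixes f :: "real \<Rightarrow> 'a::real_normed_vector"
  assumes h: "0 < h" and cont: "continuous_on {0..h} f" and f0: "f 0 = 0" and "0 \<le> q" "q < 1" "0 \<le> \<delta>"
    and inc: "\<And>k j. j < 2 ^ k \<Longrightarrow> norm (f (h * (real j + 1) / 2 ^ k) - f (h * real j / 2 ^ k)) \<le> \<delta> * (1 - q) * q ^ k"
    and t: "0 \<le> t" "t \<le> h"
  shows "norm (f t) \<le> \<delta>"
proof -
  \<comment> \<open>An even index names a point of the previous level; an odd one is a single
    level-\<open>k\<close> increment to the right of such a point.\<close>
  have S: "norm (f (h * real j / 2 ^ k)) \<le> (\<Sum>i\<le>k. \<delta> * (1 - q) * q ^ i)" if "j \<le> 2 ^ k" for k j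
    using that
  proof (induction k arbitrary: j)
    case 0
    then have "j = 0 \<or> j = 1" by auto
    then show ?case using inc[of 0 0] f0 \<open>0 \<le> \<delta>\<close> \<open>q < 1\<close> by auto
  next
    case (Suc k)
    have ev: "h * real (2 * i) / 2 ^ Suc k = h * real i / 2 ^ k" for i by simp
    have n: "0 \<le> \<delta> * (1 - q) * q ^ Suc k" using assms by simp
    show ?case
    proof (cases "even j")
      case True
      then obtain i where j: "j = 2 * i" by (elim evenE)
      then have "i \<le> 2 ^ k" using Suc.prems by simp
      from Suc.IH[OF this] show ?thesis using n unfolding j ev sum.atMost_Suc by linarith
    next
      case False
      then obtain i where j: "j = 2 * i + 1" by (elim oddE)
      then have i: "i \<le> 2 ^ k" "2 * i < 2 ^ Suc k" using Suc.prems by auto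
      have "norm (f (h * real j / 2 ^ Suc k)) \<le> norm (f (h * real i / 2 ^ k))
          + norm (f (h * real j / 2 ^ Suc k) - f (h * real i / 2 ^ k))" by norm
      also have "\<dots> \<le> (\<Sum>i\<le>k. \<delta> * (1 - q) * q ^ i) + \<delta> * (1 - q) * q ^ Suc k"
        using inc[OF i(2)] unfolding ev j by (intro add_mono Suc.IH[OF i(1)]) (simp add: add.commute)
      finally show ?thesis by simp
    qed
  qed
  have geo: "(\<Sum>i\<le>k. \<delta> * (1 - q) * q ^ i) \<le> \<delta>" for k
  proof -
    have "(1 - q) * (\<Sum>i\<le>k. q ^ i) = 1 - q ^ Suc k" by (rule sum_gp_basic)
    then have "(1 - q) * (\<Sum>i\<le>k. q ^ i) \<le> 1" using \<open>0 \<le> q\<close> by simp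
    then have "\<delta> * ((1 - q) * (\<Sum>i\<le>k. q ^ i)) \<le> \<delta> * 1" using \<open>0 \<le> \<delta>\<close> by (rule mult_left_mono)
    then show ?thesis by (simp add: sum_distrib_left mult.assoc)
  qed
  \<comment> \<open>Level-\<open>k\<close> dyadic approximation of \<open>t\<close> from
    below.\<close>
  define T where "T k = h * real (nat \<lfloor>2 ^ k * (t / h)\<rfloor>) / 2 ^ k" for k
  have fl: "real (nat \<lfloor>2 ^ k * (t / h)\<rfloor>) \<le> 2 ^ k * (t / h)" "2 ^ k * (t / h) - 1 \<le> real (nat \<lfloor>2 ^ k * (t / h)\<rfloor>)" for k
    using t h by (simp_all add: of_nat_nat) 
  have T1: "T k \<le> t" for k
    using mult_left_mono[OF fl(1)[of k], of h] h by (simp add: T_def field_simps)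
  have T2: "t - h * (1/2) ^ k \<le> T k" for k
    using mult_right_mono[OF divide_right_mono[OF fl(2)[of k], of "2 ^ k"], of h] h
    by (simp add: T_def diff_divide_distrib right_diff_distrib power_one_over inverse_eq_divide mult.commute)
  have T0: "0 \<le> T k" for k unfolding T_def using h by simp
  have "(\<lambda>k. t - h * (1/2) ^ k) \<longlonglongrightarrow> t - h * 0" by (intro tendsto_intros LIMSEQ_realpow_zero) auto
  then have "T \<longlonglongrightarrow> t"
    by (intro tendsto_sandwich[where f = "\<lambda>k. t - h * (1/2) ^ k" and h = "\<lambda>_. t" and g = T]) (auto simp: T1 T2)
  then have lim: "(\<lambda>k. f (T k)) \<longlonglongrightarrow> f t"
    using continuous_on_tendsto_compose[OF cont, of T t sequentially] t T0 T1 order_trans[OF T1 t(2)] by auto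
  have "norm (f (T k)) \<le> \<delta>" for k
  proof -
    have "t / h \<le> 1" using t h by simp
    then have "2 ^ k * (t / h) \<le> 2 ^ k * 1" by (intro mult_left_mono) auto
    then have "real (nat \<lfloor>2 ^ k * (t / h)\<rfloor>) \<le> 2 ^ k"
      using fl(1)[of k] by linarith
    then have "nat \<lfloor>2 ^ k * (t / h)\<rfloor> \<le> 2 ^ k" by (metis of_nat_le_iff of_nat_numeral of_nat_power)
    then show ?thesis unfolding T_def using S geo order_trans by blast
  qed
  then show ?thesis using tendsto_norm[OF lim] by (intro LIMSEQ_le_const2) auto
qed

text \<open>Markov's inequality for fourth moments and a union bound over all dyadic increments. The
  order \<open>h\<^sup>2\<close> matters: an exceptional event of this size is negligible against a
  drift of order \<open>h\<close>.\<close>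

lemma (in prob_space) continuous_process_sup_bound:
  fixes B :: "real \<Rightarrow> 'a \<Rightarrow> 'b::euclidean_space"
  assumes [measurable]: "\<And>t. B t \<in> borel_measurable M"
    and int: "\<And>s t. \<lbrakk>0 \<le> s; s < t\<rbrakk> \<Longrightarrow> integrable M (\<lambda>\<omega>. norm (B t \<omega> - B s \<omega>) ^ 4)"
    and mom: "\<And>s t. \<lbrakk>0 \<le> s; s < t\<rbrakk> \<Longrightarrow> expectation (\<lambda>\<omega>. norm (B t \<omega> - B s \<omega>) ^ 4) \<le> C * (t - s)\<^sup>2"
    and "0 < h" "0 < \<delta>"
  obtains N where "N \<in> events" "prob N \<le> 50000 * C * h\<^sup>2 / \<delta> ^ 4"
    "\<And>\<omega> t. \<lbrakk>\<omega> \<in> space M; \<omega> \<notin> N; B 0 \<omega> = 0; continuous_on {0..} (\<lambda>t. B t \<omega>); 0 \<le> t; t \<le> h\<rbrakk> \<Longrightarrow> norm (B t \<omega>) \<le> \<delta>"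
proof -
  \<comment> \<open>Level \<open>k\<close> has \<open>2 ^ k\<close> increments, each with fourth
    moment of order \<open>4 ^ (-k)\<close>, so ratio \<open>q\<close> leaves the series with ratio
    \<open>1 / (2 * q ^ 4)\<close>. The choice \<open>9/10\<close> makes it
    \<open>5000/6561 < 1\<close>, and \<open>1 - q = 1/10\<close> produces the factor 10000.\<close>
  define a where "a k = \<delta> * (1 - 9/10) * (9/10) ^ k" for k :: nat
  have a: "0 < a k" for k using \<open>0 < \<delta>\<close> by (simp add: a_def)
  define E where "E k j = {\<omega>\<in>space M. a k ^ 4 \<le> norm (B (h * (real j + 1) / 2 ^ k) \<omega> - B (h * real j / 2 ^ k) \<omega>) ^ 4}" for k j :: nat
  have [measurable]: "E k j \<in> events" for k j unfolding E_def by measurable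
  define N where "N = (\<Union>k. \<Union>j<2^k. E k j)"
  have "0 \<le> expectation (\<lambda>\<omega>. norm (B 1 \<omega> - B 0 \<omega>) ^ 4)" by simp
  also have "\<dots> \<le> C" using mom[of 0 1] by simp
  finally have C: "0 \<le> C" .
  have Ekj: "prob (E k j) \<le> C * (h / 2 ^ k)\<^sup>2 / a k ^ 4" for k j
  proof -
    let ?s = "h * real j / 2 ^ k" and ?t = "h * (real j + 1) / 2 ^ k"
    have s: "0 \<le> ?s" "?s < ?t" using \<open>0 < h\<close> by (auto simp: divide_strict_right_mono)
    have "?t - ?s = h / 2 ^ k" by (simp add: field_simps)
    then have m: "expectation (\<lambda>\<omega>. norm (B ?t \<omega> - B ?s \<omega>) ^ 4) \<le> C * (h / 2 ^ k)\<^sup>2" using mom[OF s] by simp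
    have "prob (E k j) \<le> expectation (\<lambda>\<omega>. norm (B ?t \<omega> - B ?s \<omega>) ^ 4) / a k ^ 4"
      unfolding E_def using a[of k] by (intro integral_Markov_inequality_measure[OF int[OF s], of "{}"]) auto
    also have "\<dots> \<le> C * (h / 2 ^ k)\<^sup>2 / a k ^ 4" using m a[of k] by (intro divide_right_mono) auto
    finally show ?thesis .
  qed
  have Pk: "prob (\<Union>j<2^k. E k j) \<le> 10000 * C * h\<^sup>2 / \<delta> ^ 4 * (5000/6561) ^ k" for k
  proof -
    have "prob (\<Union>j<2^k. E k j) \<le> (\<Sum>j<2^k. prob (E k j))"
      by (rule finite_measure_subadditive_finite) auto
    also have "\<dots> \<le> (\<Sum>j<(2::nat)^k. C * (h / 2 ^ k)\<^sup>2 / a k ^ 4)" by (intro sum_mono Ekj)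
    also have "\<dots> = 10000 * C * h\<^sup>2 / \<delta> ^ 4 * (5000/6561) ^ k"
    proof -
      have A: "a k ^ 4 = \<delta> ^ 4 / 10000 * (6561/10000) ^ k"
        unfolding a_def power_mult_distrib power_mult[symmetric] mult.commute[of k 4]
        by (simp add: power_mult power_divide)
      have P: "(2::real) ^ k * (1 / 2 ^ k)\<^sup>2 = (1/2) ^ k" by (simp add: power2_eq_square power_divide)
      have Q: "(1/2::real) ^ k / (6561/10000) ^ k = (5000/6561) ^ k" by (simp add: power_divide[symmetric])
      have "(\<Sum>j<(2::nat)^k. C * (h / 2 ^ k)\<^sup>2 / a k ^ 4) = C * h\<^sup>2 * (2 ^ k * (1 / 2 ^ k)\<^sup>2) / a k ^ 4"
        by (simp add: power_divide)
      also have "\<dots> = 10000 * C * h\<^sup>2 / \<delta> ^ 4 * ((1/2) ^ k / (6561/10000) ^ k)"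
        unfolding P A by simp
      finally show ?thesis unfolding Q .
    qed
    finally show ?thesis .
  qed
  have sm: "summable (\<lambda>k. 10000 * C * h\<^sup>2 / \<delta> ^ 4 * (5000/6561::real) ^ k)"
    by (intro summable_mult summable_geometric) simp
  have sp: "summable (\<lambda>k. prob (\<Union>j<2^k. E k j))"
    by (rule summable_comparison_test'[OF sm]) (use Pk in auto)
  show thesis
  proof (rule that[of N])
    show "N \<in> events" unfolding N_def by measurable
    have "prob N \<le> (\<Sum>k. prob (\<Union>j<2^k. E k j))"
      unfolding N_def by (rule finite_measure_subadditive_countably[OF _ sp]) auto
    also have "\<dots> \<le> (\<Sum>k. 10000 * C * h\<^sup>2 / \<delta> ^ 4 * (5000/6561) ^ k)" by (rule suminf_le[OF Pk sp sm])
    also have "\<dots> = 10000 * C * h\<^sup>2 / \<delta> ^ 4 * (1 / (1 - 5000/6561))"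
      by (subst suminf_mult) (auto simp: suminf_geometric)
    \<comment> \<open>The geometric sum is \<open>6561/1561\<close>, which is below 5.\<close>
    also have "\<dots> \<le> 10000 * C * h\<^sup>2 / \<delta> ^ 4 * 5" using C by (intro mult_left_mono) auto
    finally show "prob N \<le> 50000 * C * h\<^sup>2 / \<delta> ^ 4" by simp
    fix \<omega> t
    assume \<omega>: "\<omega> \<in> space M" "\<omega> \<notin> N" "B 0 \<omega> = 0" "continuous_on {0..} (\<lambda>t. B t \<omega>)" and t: "0 \<le> t" "t \<le> h"
    show "norm (B t \<omega>) \<le> \<delta>"
    proof (rule norm_le_of_dyadic_increments[where h = h and q = "9/10" and f = "\<lambda>t. B t \<omega>"])
      fix k j :: nat assume "j < 2 ^ k"
      then have "\<omega> \<notin> E k j" using \<omega> unfolding N_def by auto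
      then have "norm (B (h * (real j + 1) / 2 ^ k) \<omega> - B (h * real j / 2 ^ k) \<omega>) ^ 4 < a k ^ 4"
        using \<omega>(1) unfolding E_def by auto
      then have "norm (B (h * (real j + 1) / 2 ^ k) \<omega> - B (h * real j / 2 ^ k) \<omega>) \<le> a k"
        using a[of k] power_less_imp_less_base[of _ 4 "a k"] by fastforce
      then show "norm (B (h * (real j + 1) / 2 ^ k) \<omega> - B (h * real j / 2 ^ k) \<omega>) \<le> \<delta> * (1 - 9/10) * (9/10) ^ k"
        unfolding a_def .
    qed (use \<omega> t \<open>0 < h\<close> \<open>0 < \<delta>\<close> in \<open>auto intro: continuous_on_subset\<close>)
  qed
qed

section \<open>Short-time increments of reflected Brownian motion\<close>

text \<open>The contribution of one particle, moving by \<open>a\<close>, to a lower bound for the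
  change of the potential: first-order term, rank-one second-order term, and isotropic quadratic and
  cubic penalties. For a Brownian increment over time \<open>h\<close> the first three terms have
  mean \<open>(\<sigma> * (norm m)\<^sup>2 - A * n) * h\<close> in dimension \<open>n\<close>, and
  the cubic term is of smaller order.\<close>

definition increment_functional :: "real \<Rightarrow> real \<Rightarrow> 'a::real_inner \<Rightarrow> 'a \<Rightarrow> real \<Rightarrow> 'a \<Rightarrow> real" where
  "increment_functional A Q l m \<sigma> a = l \<bullet> a + \<sigma> * (m \<bullet> a)\<^sup>2 - A * (norm a)\<^sup>2 - Q * norm a ^ 3"

lemma abs_inner_le_mult:
  assumes "norm (m::'a::real_inner) \<le> \<Lambda>" shows "\<bar>m \<bullet> v\<bar> \<le> \<Lambda> * norm v"
  using order_trans[OF Cauchy_Schwarz_ineq2 mult_right_mono[OF assms norm_ge_zero]] .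

lemma increment_functional_abs_le:
  assumes "norm l \<le> \<Lambda>" "norm m \<le> \<Lambda>" "\<bar>\<sigma>\<bar> \<le> \<Lambda>" "0 \<le> A" "0 \<le> Q" "norm a \<le> E"
  shows "\<bar>increment_functional A Q l m \<sigma> a\<bar> \<le> \<Lambda> * E + \<Lambda> ^ 3 * E\<^sup>2 + A * E\<^sup>2 + Q * E ^ 3"
proof -
  have \<Lambda>: "0 \<le> \<Lambda>" using assms(1) norm_ge_zero order_trans by blast
  have l: "\<bar>l \<bullet> a\<bar> \<le> \<Lambda> * E"
    using abs_inner_le_mult[OF assms(1), of a] mult_left_mono[OF assms(6) \<Lambda>] by linarith
  have m: "\<bar>m \<bullet> a\<bar> \<le> \<Lambda> * E"
    using abs_inner_le_mult[OF assms(2), of a] mult_left_mono[OF assms(6) \<Lambda>] by linarith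
  have "\<bar>\<sigma> * (m \<bullet> a)\<^sup>2\<bar> = \<bar>\<sigma>\<bar> * \<bar>m \<bullet> a\<bar>\<^sup>2" by (simp add: abs_mult)
  also have "\<dots> \<le> \<Lambda> * (\<Lambda> * E)\<^sup>2" using m assms(3) \<Lambda> by (intro mult_mono power_mono) auto
  finally have "\<bar>\<sigma> * (m \<bullet> a)\<^sup>2\<bar> \<le> \<Lambda> ^ 3 * E\<^sup>2" by (simp add: power_mult_distrib eval_nat_numeral ac_simps)
  moreover have "A * (norm a)\<^sup>2 \<le> A * E\<^sup>2" using assms by (intro mult_left_mono power_mono) auto
  moreover have "Q * norm a ^ 3 \<le> Q * E ^ 3" using assms by (intro mult_left_mono power_mono) auto
  moreover have "0 \<le> A * (norm a)\<^sup>2" "0 \<le> Q * norm a ^ 3" using assms by auto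
  ultimately show ?thesis using l unfolding increment_functional_def by linarith
qed

text \<open>Every error involving the push \<open>k\<close> carries a factor
  \<open>\<delta> * norm k\<close>, so for small \<delta> the linear gain \<open>c * norm k\<close>
  pays for all of them. What remains is the functional of the Brownian part \<open>b\<close>, its
  cubic term traded for a quadratic one with coefficient of order \<delta>.\<close>

lemma increment_functional_push_ge:
  assumes l: "c * norm k \<le> l \<bullet> k" and m: "norm m \<le> \<Lambda>" and \<sigma>: "\<bar>\<sigma>\<bar> \<le> \<Lambda>" and "0 \<le> A" "0 \<le> Q"
    and b: "norm b \<le> \<delta>" and k: "norm k \<le> C * \<delta>" and "0 \<le> C" "\<delta> \<le> 1"
    and small: "(2 + C) * \<delta> * (\<Lambda> ^ 3 + A + Q * (1 + C)) \<le> c"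
  shows "l \<bullet> b + \<sigma> * (m \<bullet> b)\<^sup>2 - (A + Q * (1 + C) * \<delta>) * (norm b)\<^sup>2
    \<le> increment_functional A Q l m \<sigma> (b + k)"
proof -
  have \<Lambda>: "0 \<le> \<Lambda>" using m norm_ge_zero order_trans by blast
  have \<delta>: "0 \<le> \<delta>" using b norm_ge_zero order_trans by blast
  \<comment> \<open>Bounds the change \<open>2 * norm b * norm k + (norm k)\<^sup>2\<close> of the
    squared norm caused by the push.\<close>
  define e where "e = (2 + C) * \<delta> * norm k"
  have e0: "0 \<le> e" using \<delta> \<open>0 \<le> C\<close> by (simp add: e_def)
  have bk: "2 * (norm b * norm k) + (norm k)\<^sup>2 \<le> e"
    using mult_right_mono[OF b, of "norm k"] mult_right_mono[OF k, of "norm k"]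
    by (simp add: e_def power2_eq_square algebra_simps)
  have "\<sigma> * (m \<bullet> b)\<^sup>2 - \<sigma> * (m \<bullet> (b + k))\<^sup>2 = - \<sigma> * (2 * (m \<bullet> b) * (m \<bullet> k) + (m \<bullet> k)\<^sup>2)"
    by (simp add: inner_add_right power2_eq_square algebra_simps)
  also have "\<dots> \<le> \<bar>\<sigma>\<bar> * \<bar>2 * (m \<bullet> b) * (m \<bullet> k) + (m \<bullet> k)\<^sup>2\<bar>"
    by (metis abs_ge_self abs_minus_cancel abs_mult)
  also have "\<dots> \<le> \<Lambda> * (\<Lambda>\<^sup>2 * e)"
  proof (rule mult_mono[OF \<sigma>])
    have "\<bar>2 * (m \<bullet> b) * (m \<bullet> k) + (m \<bullet> k)\<^sup>2\<bar> \<le> 2 * (\<bar>m \<bullet> b\<bar> * \<bar>m \<bullet> k\<bar>) + \<bar>m \<bullet> k\<bar>\<^sup>2"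
      by (rule order_trans[OF abs_triangle_ineq]) (simp add: abs_mult)
    also have "\<dots> \<le> 2 * ((\<Lambda> * norm b) * (\<Lambda> * norm k)) + (\<Lambda> * norm k)\<^sup>2"
      using abs_inner_le_mult[OF m] \<Lambda> by (intro add_mono mult_left_mono mult_mono power_mono) auto
    also have "\<dots> = \<Lambda>\<^sup>2 * (2 * (norm b * norm k) + (norm k)\<^sup>2)" by (simp add: power2_eq_square algebra_simps)
    also have "\<dots> \<le> \<Lambda>\<^sup>2 * e" using bk by (intro mult_left_mono) auto
    finally show "\<bar>2 * (m \<bullet> b) * (m \<bullet> k) + (m \<bullet> k)\<^sup>2\<bar> \<le> \<Lambda>\<^sup>2 * e" .
  qed (use \<Lambda> in auto)
  finally have s: "\<sigma> * (m \<bullet> b)\<^sup>2 - \<sigma> * (m \<bullet> (b + k))\<^sup>2 \<le> \<Lambda> ^ 3 * e" by (simp add: eval_nat_numeral mult.assoc)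
  have "(norm (b + k))\<^sup>2 \<le> (norm b + norm k)\<^sup>2" by (intro power_mono norm_triangle_ineq) auto
  also have "\<dots> \<le> (norm b)\<^sup>2 + e" using bk by (simp add: power2_sum algebra_simps)
  finally have n2: "(norm (b + k))\<^sup>2 \<le> (norm b)\<^sup>2 + e" .
  have n1: "norm (b + k) \<le> (1 + C) * \<delta>"
    using norm_triangle_ineq[of b k] b k by (simp add: algebra_simps)
  have "norm (b + k) ^ 3 = norm (b + k) * (norm (b + k))\<^sup>2" by (simp add: eval_nat_numeral)
  \<comment> \<open>One factor of the cube is small, leaving a square; \<delta> in front of
    \<open>e\<close> is then replaced by 1.\<close>
  also have "\<dots> \<le> ((1 + C) * \<delta>) * ((norm b)\<^sup>2 + e)" using n1 n2 \<delta> \<open>0 \<le> C\<close> by (intro mult_mono) auto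
  also have "\<dots> \<le> (1 + C) * \<delta> * (norm b)\<^sup>2 + (1 + C) * e"
    using mult_right_mono[OF \<open>\<delta> \<le> 1\<close>, of "(1 + C) * e"] e0 \<open>0 \<le> C\<close> by (simp add: algebra_simps)
  finally have n3: "norm (b + k) ^ 3 \<le> (1 + C) * \<delta> * (norm b)\<^sup>2 + (1 + C) * e" .
  have "(\<Lambda> ^ 3 + A + Q * (1 + C)) * e \<le> c * norm k"
    using mult_right_mono[OF small, of "norm k"] by (simp add: e_def algebra_simps)
  moreover have "(\<Lambda> ^ 3 + A + Q * (1 + C)) * e = \<Lambda> ^ 3 * e + A * e + Q * ((1 + C) * e)"
    by (simp add: algebra_simps)
  moreover have "A * (norm (b + k))\<^sup>2 \<le> A * (norm b)\<^sup>2 + A * e"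
    using mult_left_mono[OF n2 \<open>0 \<le> A\<close>] by (simp add: algebra_simps)
  moreover have "Q * norm (b + k) ^ 3 \<le> Q * (1 + C) * \<delta> * (norm b)\<^sup>2 + Q * ((1 + C) * e)"
    using mult_left_mono[OF n3 \<open>0 \<le> Q\<close>] by (simp add: algebra_simps)
  moreover have "l \<bullet> (b + k) = l \<bullet> b + l \<bullet> k" by (rule inner_add_right)
  moreover have "(A + Q * (1 + C) * \<delta>) * (norm b)\<^sup>2 = A * (norm b)\<^sup>2 + Q * (1 + C) * \<delta> * (norm b)\<^sup>2"
    by (rule distrib_right)
  ultimately show ?thesis using l s unfolding increment_functional_def by linarith
qed

text \<open>The step bound \<open>h0\<close> is chosen before the measure, the starting point and
  \<open>l\<close>, \<open>m\<close>, \<sigma>, so it is uniform in all of them. Outside an event of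
  probability \<open>O(h\<^sup>2)\<close> the driving path stays within \<delta> and the pathwise
  bounds reduce the claim to Brownian moments; on that event crude bounds cost only
  \<open>O(h\<^sup>2)\<close>.\<close>

lemma reflected_bm_increment_functional_ge:
  fixes D :: "(real^'n) set" and \<nu> :: "real^'n \<Rightarrow> real^'n" and R r c \<rho> \<Lambda> A Q \<kappa> :: real
  assumes D: "open D" "closure D \<subseteq> cball 0 R" "ball z r \<subseteq> D" "0 < r"
    and nu: "\<nu> \<in> borel_measurable borel"
    and nun: "\<forall>x\<in>frontier D. norm (\<nu> x) = 1 \<and> (\<forall>y\<in>closure D. 0 \<le> (y - x) \<bullet> \<nu> x)"
    and pos: "0 < c" "0 < \<rho>" "0 \<le> \<Lambda>" "0 \<le> A" "0 \<le> Q" "0 < \<kappa>"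
  shows "\<exists>h0>0. \<forall>h (M :: 'w measure) x X l m \<sigma>.
    0 < h \<longrightarrow> h \<le> h0 \<longrightarrow> reflected_bm D \<nu> M x X \<longrightarrow> x \<in> closure D \<longrightarrow>
    norm l \<le> \<Lambda> \<longrightarrow> norm m \<le> \<Lambda> \<longrightarrow> \<bar>\<sigma>\<bar> \<le> \<Lambda> \<longrightarrow>
    (\<forall>u\<in>frontier D. norm (u - x) \<le> \<rho> \<longrightarrow> c \<le> l \<bullet> \<nu> u) \<longrightarrow>
    (\<sigma> * (norm m)\<^sup>2 - A * CARD('n) - \<kappa>) * h \<le> (\<integral>\<omega>. increment_functional A Q l m \<sigma> (X h \<omega> - x) \<partial>M)"
proof -
  have R: "0 \<le> R"
  proof -
    have "z \<in> closure D" using D(3,4) closure_subset[of D] centre_in_ball[of z r] by blast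
    then have "norm z \<le> R" using D(2) by auto
    then show ?thesis using norm_ge_zero[of z] by linarith
  qed
  define n where "n = real CARD('n)"
  have n: "0 < n" unfolding n_def by simp
  define C where "C = 8 * R / r"
  have C: "0 \<le> C" using R D(4) by (simp add: C_def)
  define S where "S = \<Lambda> ^ 3 + A + Q * (1 + C)"
  have S: "0 \<le> S" using pos C by (simp add: S_def)
  \<comment> \<open>In order: the cubic estimate, the Skorokhod bound, keeping visited frontier
    points within \<rho> of \<open>x\<close>, absorbing the push errors into \<open>c\<close>, and
    keeping the extra quadratic coefficient below half of the allowance \<kappa>.\<close>
  define \<delta> where "\<delta> = Min {1, r / 2, \<rho> / (1 + C), c / ((2 + C) * (S + 1)), \<kappa> / (2 * n * (Q * (1 + C) + 1))}"
  have \<delta>0: "0 < \<delta>"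
    unfolding \<delta>_def using D(4) pos C S n by (auto intro!: divide_pos_pos mult_pos_pos add_nonneg_pos)
  have \<delta>: "\<delta> \<le> 1" "\<delta> \<le> r / 2" "\<delta> \<le> \<rho> / (1 + C)" "\<delta> \<le> c / ((2 + C) * (S + 1))"
      "\<delta> \<le> \<kappa> / (2 * n * (Q * (1 + C) + 1))"
    unfolding \<delta>_def by (rule Min_le; simp)+
  have \<delta>\<rho>: "(1 + C) * \<delta> \<le> \<rho>" using \<delta>(3) C by (simp add: pos_le_divide_eq mult.commute)
  have \<delta>c: "(2 + C) * \<delta> * S \<le> c"
  proof -
    have "\<delta> * ((2 + C) * (S + 1)) \<le> c" using \<delta>(4) C S by (simp add: pos_le_divide_eq add_nonneg_pos)
    moreover have "0 \<le> (2 + C) * \<delta>" using C \<delta>0 by simp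
    ultimately show ?thesis by (simp add: algebra_simps)
  qed
  have \<delta>\<kappa>: "Q * (1 + C) * \<delta> * n \<le> \<kappa> / 2"
  proof -
    have "0 < 2 * n * (Q * (1 + C) + 1)" using n pos C by (intro mult_pos_pos add_nonneg_pos) auto
    then have "\<delta> * (2 * n * (Q * (1 + C) + 1)) \<le> \<kappa>" using \<delta>(5) by (simp add: pos_le_divide_eq)
    moreover have "0 \<le> n * \<delta>" using n \<delta>0 by simp
    ultimately show ?thesis by (simp add: algebra_simps)
  qed
  define C1 where "C1 = \<Lambda> * (2 * R) + \<Lambda> ^ 3 * (2 * R)\<^sup>2 + A * (2 * R)\<^sup>2 + Q * (2 * R) ^ 3"
  have C1: "0 \<le> C1" using pos R by (simp add: C1_def)
  define C2 where "C2 = \<Lambda> + \<Lambda> ^ 3"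
  have C2: "0 \<le> C2" using pos by (simp add: C2_def)
  \<comment> \<open>\<open>C3 * h\<^sup>2\<close> is the total cost of the exceptional event and of
    the fourth-moment correction; \<open>h0\<close> makes it at most
    \<open>\<kappa> / 2 * h\<close>.\<close>
  define C3 where "C3 = (C1 + C2) * (50000 * (3 * n\<^sup>2) / \<delta> ^ 4) + C2 * (3 * n\<^sup>2)"
  have C3: "0 \<le> C3" using C1 C2 \<delta>0 by (simp add: C3_def)
  define h0 where "h0 = \<kappa> / (2 * (C3 + 1))"
  have h0: "0 < h0" using pos C3 by (simp add: h0_def)
  show ?thesis
  proof (intro exI[of _ h0] conjI h0 allI impI)
    fix h and M :: "'w measure" and x and X :: "real \<Rightarrow> 'w \<Rightarrow> real^'n" and l m :: "real^'n" and \<sigma> :: real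
    assume h: "0 < h" "h \<le> h0" and rbm: "reflected_bm D \<nu> M x X" and x: "x \<in> closure D"
      and l: "norm l \<le> \<Lambda>" and m: "norm m \<le> \<Lambda>" and \<sigma>: "\<bar>\<sigma>\<bar> \<le> \<Lambda>"
      and inw: "\<forall>u\<in>frontier D. norm (u - x) \<le> \<rho> \<longrightarrow> c \<le> l \<bullet> \<nu> u"
    let ?F = "increment_functional A Q l m \<sigma>"
    from rbm obtain B L where X[measurable]: "\<And>t. X t \<in> borel_measurable M" and bm: "brownian_motion M B"
      and ae: "AE \<omega> in M.
           L 0 \<omega> = 0 \<and>
           mono_on {0..} (\<lambda>t. L t \<omega>) \<and>
           continuous_on {0..} (\<lambda>t. L t \<omega>) \<and>
           (\<forall>t\<ge>0. X t \<omega> \<in> closure D) \<and>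
           (\<forall>t\<ge>0. X t \<omega> = x + B t \<omega> +
               (LINT s:{0..t}|stieltjes (\<lambda>r. L r \<omega>). \<nu> (X s \<omega>))) \<and>
           emeasure (stieltjes (\<lambda>r. L r \<omega>)) {s. 0 \<le> s \<and> X s \<omega> \<in> D} = 0"
      unfolding reflected_bm_def by (elim conjE exE) blast
    interpret prob_space M using bm by (simp add: brownian_motion_def)
    have [measurable]: "B t \<in> borel_measurable M" for t using bm by (simp add: brownian_motion_def)
    have B0: "AE \<omega> in M. B 0 \<omega> = 0 \<and> continuous_on {0..} (\<lambda>t. B t \<omega>)" using bm by (simp add: brownian_motion_def)
    have inc: "indep_vars (\<lambda>_. borel) (\<lambda>i \<omega>. (B t \<omega> - B s \<omega>) $ i) UNIV"
        "\<And>i. distributed M lborel (\<lambda>\<omega>. (B t \<omega> - B s \<omega>) $ i) (normal_density 0 (sqrt (t - s)))"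
      if "0 \<le> s" "s < t" for s t
      using bm that unfolding brownian_motion_def by blast+
    have mB: "(\<lambda>\<omega>. B t \<omega> - B s \<omega>) \<in> borel_measurable M" for s t by measurable
    have q4: "sqrt (t - s) ^ 4 = (t - s)\<^sup>2" if "s < t" for s t :: real
      using that by (simp add: power4_eq_xxxx power2_eq_square)
    have mom: "integrable M (\<lambda>\<omega>. norm (B t \<omega> - B s \<omega>) ^ 4)"
        "expectation (\<lambda>\<omega>. norm (B t \<omega> - B s \<omega>) ^ 4) \<le> (3 * n\<^sup>2) * (t - s)\<^sup>2" if "0 \<le> s" "s < t" for s t
      using indep_normal_vector_moments(1,2)[OF inc[OF that] _ mB] q4[OF that(2)] that by (simp_all add: n_def)
    \<comment> \<open>Since \<open>B 0\<close> vanishes only almost surely, it is subtracted to make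
      \<open>V\<close> a genuine increment.\<close>
    define V where "V \<omega> = B h \<omega> - B 0 \<omega>" for \<omega>
    have [measurable]: "V \<in> borel_measurable M" unfolding V_def by measurable
    have sq: "0 < sqrt (h - 0)" using h by simp
    note V = indep_normal_vector_moments[OF inc[of 0 h, OF order_refl h(1)] sq mB, folded V_def]
    from continuous_process_sup_bound[of B "3 * n\<^sup>2" h \<delta>, OF _ mom h(1) \<delta>0]
    obtain N where N[measurable]: "N \<in> events" and PN: "prob N \<le> 50000 * (3 * n\<^sup>2) * h\<^sup>2 / \<delta> ^ 4"
      and BN: "\<And>\<omega> t. \<lbrakk>\<omega> \<in> space M; \<omega> \<notin> N; B 0 \<omega> = 0; continuous_on {0..} (\<lambda>t. B t \<omega>); 0 \<le> t; t \<le> h\<rbrakk>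
        \<Longrightarrow> norm (B t \<omega>) \<le> \<delta>"
      by (metis \<open>\<And>t. B t \<in> borel_measurable M\<close>)
    define H where "H \<omega> = l \<bullet> V \<omega> + \<sigma> * (m \<bullet> V \<omega>)\<^sup>2 - (A + Q * (1 + C) * \<delta>) * (norm (V \<omega>))\<^sup>2" for \<omega>
    have aeX: "AE \<omega> in M. norm (X h \<omega> - x) \<le> 2 * R"
      using ae
    proof eventually_elim
      case (elim \<omega>)
      then have "X h \<omega> \<in> closure D" using h by auto
      then have "norm (X h \<omega>) \<le> R" "norm x \<le> R" using x D(2) by auto
      then show ?case using norm_triangle_ineq4[of "X h \<omega>" x] by linarith
    qed
    \<comment> \<open>On \<open>N\<close> the left functional \<open>H\<close> is unbounded, so
      \<open>C2 * norm (V \<omega>) ^ 4\<close> is subtracted as well; its mean is of order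
      \<open>h\<^sup>2\<close>.\<close>
    have bound: "AE \<omega> in M. H \<omega> - ((C1 + C2) * indicator N \<omega> + C2 * norm (V \<omega>) ^ 4) \<le> ?F (X h \<omega> - x)"
      using ae B0 aeX AE_space
    proof eventually_elim
      case (elim \<omega>)
      show ?case
      proof (cases "\<omega> \<in> N")
        case False
        have path: "closure D \<subseteq> cball 0 R" "x \<in> closure D" "0 \<le> h" using D x h by auto
        have X_eq: "X t \<omega> = x + B t \<omega> + (LINT s:{0..t}|stieltjes (\<lambda>r. L r \<omega>). \<nu> (X s \<omega>))" if "0 \<le> t" for t
          using elim(1) that by blast
        have Xc: "X t \<omega> \<in> closure D" if "0 \<le> t" for t using elim(1) that by blast
        have Bd: "norm (B s \<omega>) \<le> \<delta>" if "0 \<le> s" "s \<le> h" for s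
          using BN elim(2,4) False that by blast
        note sk = skorokhod_convex_path_bounds[where X = "\<lambda>t. X t \<omega>" and B = "\<lambda>t. B t \<omega>" and L = "\<lambda>t. L t \<omega>"
            and h = h and \<delta> = \<delta>, OF D nu nun x _ _ _ _ path(3) Xc X_eq _ Bd \<delta>(2)]
        define k where "k = X h \<omega> - x - B h \<omega>"
        have k1: "norm k \<le> C * \<delta>"
          unfolding k_def C_def using sk(1) elim(1,2) by auto
        have k2: "c * norm k \<le> l \<bullet> k"
          unfolding k_def by (rule sk(2)) (use elim(1,2) inw pos \<delta>\<rho> in \<open>auto simp: C_def\<close>)
        have V_eq: "V \<omega> = B h \<omega>" using elim(2) by (simp add: V_def)
        have "H \<omega> \<le> ?F (V \<omega> + k)"
          unfolding H_def
          by (rule increment_functional_push_ge[OF k2 m \<sigma> _ _ _ k1 C \<delta>(1)])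
             (use pos Bd[of h] h \<delta>c in \<open>auto simp: V_eq S_def\<close>)
        moreover have "V \<omega> + k = X h \<omega> - x" unfolding V_eq k_def by simp
        moreover have "0 \<le> C2 * norm (V \<omega>) ^ 4" using C2 by simp
        ultimately show ?thesis using False by simp
      next
        case True
        have F: "- C1 \<le> ?F (X h \<omega> - x)"
          using increment_functional_abs_le[OF l m \<sigma> pos(4,5) elim(3)] unfolding C1_def by linarith
        define b where "b = norm (V \<omega>)"
        have b0: "0 \<le> b" by (simp add: b_def)
        have b24: "b\<^sup>2 \<le> 1 + b ^ 4"
          using zero_le_power2[of "b\<^sup>2 - 1/2"] by (simp add: power2_diff power_divide flip: power_mult) 
        have b14: "b \<le> 1 + b ^ 4"
        proof -
          have "0 \<le> (b\<^sup>2 - 1/2)\<^sup>2 + (b - 1/2)\<^sup>2" by simp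
          then show ?thesis by (simp add: power2_diff power_divide flip: power_mult)
        qed
        have "l \<bullet> V \<omega> \<le> \<Lambda> * b" using abs_inner_le_mult[OF l, of "V \<omega>"] by (simp add: b_def)
        also have "\<dots> \<le> \<Lambda> * (1 + b ^ 4)" using b14 pos by (intro mult_left_mono) auto
        finally have l1: "l \<bullet> V \<omega> \<le> \<Lambda> * (1 + b ^ 4)" .
        have "\<sigma> * (m \<bullet> V \<omega>)\<^sup>2 \<le> \<Lambda> * (\<Lambda> * b)\<^sup>2"
        proof (rule mult_mono)
          have "\<bar>m \<bullet> V \<omega>\<bar>\<^sup>2 \<le> (\<Lambda> * b)\<^sup>2"
            using abs_inner_le_mult[OF m, of "V \<omega>"] unfolding b_def by (intro power_mono) auto
          then show "(m \<bullet> V \<omega>)\<^sup>2 \<le> (\<Lambda> * b)\<^sup>2" by simp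
        qed (use \<sigma> pos in auto)
        also have "\<dots> = \<Lambda> ^ 3 * b\<^sup>2" by (simp add: power_mult_distrib eval_nat_numeral ac_simps)
        also have "\<dots> \<le> \<Lambda> ^ 3 * (1 + b ^ 4)" using b24 pos by (intro mult_left_mono) auto
        finally have m1: "\<sigma> * (m \<bullet> V \<omega>)\<^sup>2 \<le> \<Lambda> ^ 3 * (1 + b ^ 4)" .
        have "0 \<le> (A + Q * (1 + C) * \<delta>) * (norm (V \<omega>))\<^sup>2" using pos C \<delta>0 by simp
        then have "H \<omega> \<le> C2 * (1 + b ^ 4)" using l1 m1 unfolding H_def C2_def distrib_right by linarith
        then show ?thesis using F True by (simp add: b_def algebra_simps)
      qed
    qed
    have intF: "integrable M (\<lambda>\<omega>. ?F (X h \<omega> - x))"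
    proof (rule integrable_const_bound[where B = C1])
      show "AE \<omega> in M. norm (?F (X h \<omega> - x)) \<le> C1"
        using aeX
        by eventually_elim (simp only: C1_def real_norm_def increment_functional_abs_le[OF l m \<sigma> pos(4,5)])
      show "(\<lambda>\<omega>. ?F (X h \<omega> - x)) \<in> borel_measurable M" unfolding increment_functional_def by measurable
    qed
    have intH: "integrable M H" unfolding H_def using V(3,5,7) by simp
    have iN: "integrable M (\<lambda>\<omega>. indicat_real N \<omega>)"
      by (rule integrable_const_bound[where B = 1]) (auto simp: indicator_def)
    have EH: "expectation H = \<sigma> * (norm m)\<^sup>2 * h - (A + Q * (1 + C) * \<delta>) * (n * h)"
      unfolding H_def using V(3-8) h by (simp add: n_def)
    have "(\<sigma> * (norm m)\<^sup>2 - A * n - \<kappa>) * h \<le> expectation H - ((C1 + C2) * prob N + C2 * expectation (\<lambda>\<omega>. norm (V \<omega>) ^ 4))"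
    proof -
      have "(C1 + C2) * prob N \<le> (C1 + C2) * (50000 * (3 * n\<^sup>2) * h\<^sup>2 / \<delta> ^ 4)"
        using PN C1 C2 by (intro mult_left_mono) auto
      moreover have "C2 * expectation (\<lambda>\<omega>. norm (V \<omega>) ^ 4) \<le> C2 * (3 * n\<^sup>2 * h\<^sup>2)"
        using mom(2)[of 0 h] h C2 by (intro mult_left_mono) (auto simp: V_def)
      moreover have "(C1 + C2) * (50000 * (3 * n\<^sup>2) * h\<^sup>2 / \<delta> ^ 4) + C2 * (3 * n\<^sup>2 * h\<^sup>2) = C3 * h * h"
        by (simp add: C3_def power2_eq_square algebra_simps)
      moreover have "C3 * h \<le> \<kappa> / 2"
      proof -
        have "h * (2 * (C3 + 1)) \<le> \<kappa>" using h(2) C3 by (simp add: h0_def pos_le_divide_eq)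
        then show ?thesis using h(1) by (simp add: algebra_simps)
      qed
      then have "C3 * h * h \<le> \<kappa> / 2 * h" using h(1) by (intro mult_right_mono) auto
      moreover have "(Q * (1 + C) * \<delta> * n) * h \<le> \<kappa> / 2 * h" using \<delta>\<kappa> h(1) by (intro mult_right_mono) auto
      ultimately show ?thesis unfolding EH by (simp add: algebra_simps)
    qed
    also have "\<dots> = expectation (\<lambda>\<omega>. H \<omega> - ((C1 + C2) * indicator N \<omega> + C2 * norm (V \<omega>) ^ 4))"
      using intH V(1) iN by simp
    also have "\<dots> \<le> expectation (\<lambda>\<omega>. ?F (X h \<omega> - x))"
      using intH V(1) iN intF bound by (intro integral_mono_AE) auto
    finally show "(\<sigma> * (norm m)\<^sup>2 - A * CARD('n) - \<kappa>) * h \<le> expectation (\<lambda>\<omega>. ?F (X h \<omega> - x))"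
      by (simp add: n_def)
  qed
qed

section \<open>Conditional laws and the pursuit potential\<close>

text \<open>Measurable rounding to a finite net: the points are tried one after another, and the
  first one within \<open>d\<close> is taken.\<close>

lemma finite_valued_rounding:
  fixes V :: "'a::{metric_space, second_countable_topology} set"
  assumes "finite V" "V \<noteq> {}"
  shows "\<exists>p\<in>borel_measurable borel. range p \<subseteq> V \<and> (\<forall>w. (\<exists>v\<in>V. dist v w < d) \<longrightarrow> dist (p w) w < d)"
  using assms
proof (induction rule: finite_ne_induct)
  case (singleton v)
  show ?case by (rule bexI[of _ "\<lambda>_. v"]) auto
next
  case (insert v V)
  then obtain p where p[measurable]: "p \<in> borel_measurable borel" and "range p \<subseteq> V"
    "\<forall>w. (\<exists>v\<in>V. dist v w < d) \<longrightarrow> dist (p w) w < d" by blast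
  then show ?case
    by (intro bexI[of _ "\<lambda>w. if dist v w < d then v else p w"]) auto
qed

text \<open>Co-adaptedness identifies conditional probabilities one Borel set at a time, each up to
  its own null set. Uniform continuity on a compact product replaces \<open>f\<close> by a function
  of rounded arguments, a finite sum of \<open>F\<close>-measurable factors times indicators of
  events of \<open>Z\<close>; so only finitely many sets are involved. The weight \<open>H\<close>
  localises the lower bound to where it holds.\<close>

lemma cond_kernel_integral_ge:
  fixes W :: "'w \<Rightarrow> 'b::euclidean_space" and Z :: "'w \<Rightarrow> 'c::euclidean_space"
    and k :: "'w \<Rightarrow> 'c measure" and f :: "'b \<Rightarrow> 'c \<Rightarrow> real" and g H :: "'w \<Rightarrow> real"
  assumes "prob_space M" and sub: "subalgebra M F"
    and W[measurable]: "W \<in> borel_measurable F" and Z[measurable]: "Z \<in> borel_measurable M"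
    and "compact K" "compact E" and WK: "AE \<omega> in M. W \<omega> \<in> K" and ZE: "AE \<omega> in M. Z \<omega> \<in> E"
    and k: "AE \<omega> in M. prob_space (k \<omega>) \<and> sets (k \<omega>) = sets borel \<and> (AE z in k \<omega>. z \<in> E)"
    and co: "\<And>A. A \<in> sets borel \<Longrightarrow>
      AE \<omega> in M. real_cond_exp M F (indicator {\<eta> \<in> space M. Z \<eta> \<in> A}) \<omega> = measure (k \<omega>) A"
    and f: "continuous_on UNIV (\<lambda>p. f (fst p) (snd p))"
    and H[measurable]: "H \<in> borel_measurable F" and H01: "\<And>\<omega>. 0 \<le> H \<omega>" "\<And>\<omega>. H \<omega> \<le> 1"
    and g: "integrable M (\<lambda>\<omega>. H \<omega> * g \<omega>)"
    and low: "AE \<omega> in M. H \<omega> \<noteq> 0 \<longrightarrow> g \<omega> \<le> (\<integral>z. f (W \<omega>) z \<partial>k \<omega>)"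
  shows "integrable M (\<lambda>\<omega>. H \<omega> * f (W \<omega>) (Z \<omega>))"
    and "(\<integral>\<omega>. H \<omega> * g \<omega> \<partial>M) \<le> (\<integral>\<omega>. H \<omega> * f (W \<omega>) (Z \<omega>) \<partial>M)"
proof -
  interpret prob_space M by fact
  interpret finite_measure_subalgebra M F by unfold_locales (rule sub)
  have [measurable]: "W \<in> borel_measurable M" "H \<in> borel_measurable M"
    by (rule measurable_from_subalg[OF sub W], rule measurable_from_subalg[OF sub H])
  have "(\<lambda>p. f (fst p) (snd p)) \<in> borel_measurable (borel \<Otimes>\<^sub>M borel)"
    unfolding borel_prod using f by (rule borel_measurable_continuous_onI)
  then have fm[measurable]: "(\<lambda>(w, z). f w z) \<in> borel_measurable (borel \<Otimes>\<^sub>M borel)" by (simp add: case_prod_beta)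
  have cKE: "compact (K \<times> E)" by (intro compact_Times assms)
  have fKE: "continuous_on (K \<times> E) (\<lambda>p. f (fst p) (snd p))" by (rule continuous_on_subset[OF f]) simp
  obtain C where C: "\<And>w z. w \<in> K \<Longrightarrow> z \<in> E \<Longrightarrow> \<bar>f w z\<bar> \<le> C"
    using compact_imp_bounded[OF compact_continuous_image[OF fKE cKE]] unfolding bounded_iff by force
  have "\<not> (AE \<omega> in M. False)" by (simp add: AE_False)
  then have ne: "K \<noteq> {}" "E \<noteq> {}" using WK ZE by auto
  show int1: "integrable M (\<lambda>\<omega>. H \<omega> * f (W \<omega>) (Z \<omega>))"
  proof (rule integrable_const_bound[where B = C])
    show "AE \<omega> in M. norm (H \<omega> * f (W \<omega>) (Z \<omega>)) \<le> C"
      using WK ZE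
    proof eventually_elim
      case (elim \<omega>)
      have "\<bar>H \<omega>\<bar> * \<bar>f (W \<omega>) (Z \<omega>)\<bar> \<le> 1 * C" using H01 C elim by (intro mult_mono) auto
      then show ?case by (simp add: abs_mult)
    qed
  qed measurable
  show "(\<integral>\<omega>. H \<omega> * g \<omega> \<partial>M) \<le> (\<integral>\<omega>. H \<omega> * f (W \<omega>) (Z \<omega>) \<partial>M)"
  proof (rule field_le_epsilon)
    fix e :: real assume "0 < e"
    \<comment> \<open>Rounding is paid for twice: once under the kernel and once on returning to
      \<open>Z\<close>.\<close>
    define e' where "e' = e / 2"
    have e': "0 < e'" using \<open>0 < e\<close> by (simp add: e'_def)
    have "uniformly_continuous_on (K \<times> E) (\<lambda>p. f (fst p) (snd p))"
      by (rule compact_uniformly_continuous[OF fKE cKE])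
    then obtain d where d: "d > 0" "\<And>p p'. p \<in> K \<times> E \<Longrightarrow> p' \<in> K \<times> E \<Longrightarrow> dist p' p < d \<Longrightarrow>
        dist (f (fst p') (snd p')) (f (fst p) (snd p)) < e'"
      unfolding uniformly_continuous_on_def using e' by metis
    have d2: "0 < d / 2" using d by simp
    have "K \<subseteq> (\<Union>v\<in>K. ball v (d/2))" using d2 by force
    then obtain V1 where V1: "finite V1" "V1 \<subseteq> K" "K \<subseteq> (\<Union>v\<in>V1. ball v (d/2))"
      by (rule compactE_image[OF \<open>compact K\<close> open_ball]) blast
    have "E \<subseteq> (\<Union>v\<in>E. ball v (d/2))" using d2 by force
    then obtain V2 where V2: "finite V2" "V2 \<subseteq> E" "E \<subseteq> (\<Union>v\<in>V2. ball v (d/2))"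
      by (rule compactE_image[OF \<open>compact E\<close> open_ball]) blast
    have "V1 \<noteq> {}" "V2 \<noteq> {}" using V1(3) V2(3) ne by auto
    obtain p where p[measurable]: "p \<in> borel_measurable borel" and pr: "range p \<subseteq> V1"
      and pd: "\<And>w. w \<in> K \<Longrightarrow> dist (p w) w < d/2"
      using finite_valued_rounding[OF V1(1) \<open>V1 \<noteq> {}\<close>, of "d/2"] V1(3) by fastforce
    obtain q where q[measurable]: "q \<in> borel_measurable borel" and qr: "range q \<subseteq> V2"
      and qd: "\<And>w. w \<in> E \<Longrightarrow> dist (q w) w < d/2"
      using finite_valued_rounding[OF V2(1) \<open>V2 \<noteq> {}\<close>, of "d/2"] V2(3) by fastforce
    have close: "\<bar>f (p w) (q z) - f w z\<bar> \<le> e'" if "w \<in> K" "z \<in> E" for w z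
    proof -
      have "dist (p w, q z) (w, z) \<le> dist (p w) w + dist (q z) z"
        by (simp add: dist_prod_def sqrt_sum_squares_le_sum)
      also have "\<dots> < d" using pd qd that by fastforce
      finally have "dist (p w, q z) (w, z) < d" .
      moreover have "p w \<in> K" "q z \<in> E" using pr qr V1(2) V2(2) by blast+
      ultimately have "dist (f (p w) (q z)) (f w z) < e'"
        using d(2)[of "(w, z)" "(p w, q z)"] that by simp
      then show ?thesis by (simp add: dist_real_def)
    qed
    define B where "B u = q -` {u}" for u
    have B[measurable]: "B u \<in> sets borel" for u
      using measurable_sets[OF q, of "{u}"] by (simp add: B_def)
    have expand: "f (p w) (q z) = (\<Sum>u\<in>V2. f (p w) u * indicator (B u) z)" for w z
    proof -
      have "(\<Sum>u\<in>V2. f (p w) u * indicator (B u) z) = (\<Sum>u\<in>V2. if u = q z then f (p w) u else 0)"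
        by (intro sum.cong) (auto simp: B_def)
      then show ?thesis using V2(1) qr by (simp add: sum.delta' subset_iff)
    qed
    have fp: "(\<lambda>\<omega>. f (p (W \<omega>)) u) \<in> borel_measurable F" for u by measurable
    define m where "m u \<omega> = real_cond_exp M F (indicator {\<eta> \<in> space M. Z \<eta> \<in> B u}) \<omega>" for u \<omega>
    have [measurable]: "m u \<in> borel_measurable M" for u unfolding m_def by measurable
    have pV: "p w \<in> V1" and qV: "q z \<in> V2" for w z using pr qr by auto
    have bdf: "\<bar>f (p w) u\<bar> \<le> C" if "u \<in> V2" for w u
      using C pV that V1(2) V2(2) by blast
    have ce: "integrable M (\<lambda>\<omega>. (H \<omega> * f (p (W \<omega>)) u) * m u \<omega>)
        \<and> (\<integral>\<omega>. (H \<omega> * f (p (W \<omega>)) u) * m u \<omega> \<partial>M)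
          = (\<integral>\<omega>. (H \<omega> * f (p (W \<omega>)) u) * indicator {\<eta> \<in> space M. Z \<eta> \<in> B u} \<omega> \<partial>M)
        \<and> integrable M (\<lambda>\<omega>. (H \<omega> * f (p (W \<omega>)) u) * indicator {\<eta> \<in> space M. Z \<eta> \<in> B u} \<omega>)" if "u \<in> V2" for u
    proof -
      have i: "integrable M (\<lambda>\<omega>. (H \<omega> * f (p (W \<omega>)) u) * indicator {\<eta> \<in> space M. Z \<eta> \<in> B u} \<omega>)"
      proof (rule integrable_const_bound[where B = C])
        show "AE \<omega> in M. norm ((H \<omega> * f (p (W \<omega>)) u) * indicator {\<eta> \<in> space M. Z \<eta> \<in> B u} \<omega>) \<le> C"
        proof (rule AE_I2)
          fix \<omega>
          have "\<bar>H \<omega>\<bar> * \<bar>f (p (W \<omega>)) u\<bar> \<le> 1 * C" using H01 bdf[OF that] by (intro mult_mono) auto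
          moreover have "0 \<le> C" using bdf[OF that] abs_ge_zero order_trans by blast
          ultimately show "norm ((H \<omega> * f (p (W \<omega>)) u) * indicator {\<eta> \<in> space M. Z \<eta> \<in> B u} \<omega>) \<le> C"
            by (auto simp: abs_mult indicator_def)
        qed
      qed measurable
      show ?thesis
        unfolding m_def using real_cond_exp_intg[OF i] i fp by (auto simp: borel_measurable_times)
    qed
    \<comment> \<open>Finiteness of the net \<open>V2\<close> allows one common null set.\<close>
    have mk: "AE \<omega> in M. \<forall>u\<in>V2. m u \<omega> = measure (k \<omega>) (B u)"
      unfolding m_def using co[OF B] V2(1) by (intro AE_finite_allI) auto
    have step1: "(\<integral>\<omega>. H \<omega> * f (p (W \<omega>)) (q (Z \<omega>)) \<partial>M) = (\<integral>\<omega>. H \<omega> * (\<Sum>u\<in>V2. f (p (W \<omega>)) u * m u \<omega>) \<partial>M)"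
    proof -
      have "(\<integral>\<omega>. H \<omega> * f (p (W \<omega>)) (q (Z \<omega>)) \<partial>M)
          = (\<integral>\<omega>. (\<Sum>u\<in>V2. (H \<omega> * f (p (W \<omega>)) u) * indicator {\<eta> \<in> space M. Z \<eta> \<in> B u} \<omega>) \<partial>M)"
        by (rule Bochner_Integration.integral_cong)
           (auto simp: expand sum_distrib_left indicator_def mult.assoc intro!: sum.cong)
      also have "\<dots> = (\<Sum>u\<in>V2. \<integral>\<omega>. (H \<omega> * f (p (W \<omega>)) u) * m u \<omega> \<partial>M)"
        using ce by (subst Bochner_Integration.integral_sum) auto
      also have "\<dots> = (\<integral>\<omega>. (\<Sum>u\<in>V2. (H \<omega> * f (p (W \<omega>)) u) * m u \<omega>) \<partial>M)"
        using ce by (subst Bochner_Integration.integral_sum) auto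
      finally show ?thesis by (simp add: sum_distrib_left mult.assoc)
    qed
    have int2: "integrable M (\<lambda>\<omega>. H \<omega> * (\<Sum>u\<in>V2. f (p (W \<omega>)) u * m u \<omega>))"
      using ce by (auto simp: sum_distrib_left mult.assoc intro!: Bochner_Integration.integrable_sum)
    have int3: "integrable M (\<lambda>\<omega>. H \<omega> * f (p (W \<omega>)) (q (Z \<omega>)))"
    proof (rule integrable_const_bound[where B = C])
      have "\<bar>f (p w) (q z)\<bar> \<le> C" for w z using bdf[OF qV] .
      then have "\<bar>H \<omega>\<bar> * \<bar>f (p (W \<omega>)) (q (Z \<omega>))\<bar> \<le> 1 * C" for \<omega> using H01 by (intro mult_mono) auto
      then show "AE \<omega> in M. norm (H \<omega> * f (p (W \<omega>)) (q (Z \<omega>))) \<le> C" by (simp add: abs_mult)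
    qed measurable
    \<comment> \<open>For fixed \<omega> the finite sum is the kernel integral of the rounded
      function.\<close>
    have "(\<integral>\<omega>. H \<omega> * g \<omega> \<partial>M) \<le> (\<integral>\<omega>. H \<omega> * (\<Sum>u\<in>V2. f (p (W \<omega>)) u * m u \<omega>) + e' \<partial>M)"
    proof (rule integral_mono_AE)
      show "AE \<omega> in M. H \<omega> * g \<omega> \<le> H \<omega> * (\<Sum>u\<in>V2. f (p (W \<omega>)) u * m u \<omega>) + e'"
        using mk low k WK
      proof eventually_elim
        case (elim \<omega>)
        show ?case
        proof (cases "H \<omega> = 0")
          case False
          interpret k: prob_space "k \<omega>" using elim by blast
          have sk[measurable_cong]: "sets (k \<omega>) = sets borel" and aek: "AE z in k \<omega>. z \<in> E" using elim by auto
          have i1: "integrable (k \<omega>) (\<lambda>z. f (W \<omega>) z)"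
            using aek C elim(4) by (intro k.integrable_const_bound[where B = C]) (auto elim!: eventually_mono)
          have i2: "integrable (k \<omega>) (\<lambda>z. f (p (W \<omega>)) (q z))"
            using bdf[OF qV] by (intro k.integrable_const_bound[where B = C]) auto
          have "g \<omega> \<le> (\<integral>z. f (W \<omega>) z \<partial>k \<omega>)" using elim(2) False by blast
          also have "\<dots> \<le> (\<integral>z. f (p (W \<omega>)) (q z) + e' \<partial>k \<omega>)"
          proof (rule integral_mono_AE)
            show "AE z in k \<omega>. f (W \<omega>) z \<le> f (p (W \<omega>)) (q z) + e'"
              using aek
            proof eventually_elim
              case (elim z)
              then show ?case using close[OF \<open>W \<omega> \<in> K\<close>, of z] by linarith
            qed
          qed (use i1 i2 in auto)
          also have "\<dots> = (\<integral>z. f (p (W \<omega>)) (q z) \<partial>k \<omega>) + e'" using i2 by (simp add: k.prob_space)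
          also have "(\<integral>z. f (p (W \<omega>)) (q z) \<partial>k \<omega>) = (\<Sum>u\<in>V2. f (p (W \<omega>)) u * m u \<omega>)"
          proof -
            have iB: "integrable (k \<omega>) (\<lambda>z. f (p (W \<omega>)) u * indicator (B u) z)" for u
              by (intro integrable_mult_right k.integrable_const_bound[where B = 1]) (auto simp: indicator_def B_def)
            have "(\<integral>z. f (p (W \<omega>)) (q z) \<partial>k \<omega>) = (\<Sum>u\<in>V2. \<integral>z. f (p (W \<omega>)) u * indicator (B u) z \<partial>k \<omega>)"
              unfolding expand using iB by (rule Bochner_Integration.integral_sum)
            also have "\<dots> = (\<Sum>u\<in>V2. f (p (W \<omega>)) u * m u \<omega>)"
              using elim(1) sets_eq_imp_space_eq[OF sk] by (intro sum.cong) auto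
            finally show ?thesis .
          qed
          finally have "g \<omega> \<le> (\<Sum>u\<in>V2. f (p (W \<omega>)) u * m u \<omega>) + e'" .
          from mult_left_mono[OF this H01(1)[of \<omega>]] have "H \<omega> * g \<omega> \<le> H \<omega> * (\<Sum>u\<in>V2. f (p (W \<omega>)) u * m u \<omega>) + H \<omega> * e'"
            by (simp add: distrib_left)
          moreover have "H \<omega> * e' \<le> 1 * e'" using H01 e' by (intro mult_right_mono) auto
          ultimately show ?thesis by linarith
        qed (use e' in simp)
      qed
    qed (use g int2 in auto)
    also have "\<dots> = (\<integral>\<omega>. H \<omega> * f (p (W \<omega>)) (q (Z \<omega>)) \<partial>M) + e'"
      using int2 step1 by (simp add: prob_space)
    also have "(\<integral>\<omega>. H \<omega> * f (p (W \<omega>)) (q (Z \<omega>)) \<partial>M) \<le> (\<integral>\<omega>. H \<omega> * f (W \<omega>) (Z \<omega>) + e' \<partial>M)"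
    proof (rule integral_mono_AE)
      show "AE \<omega> in M. H \<omega> * f (p (W \<omega>)) (q (Z \<omega>)) \<le> H \<omega> * f (W \<omega>) (Z \<omega>) + e'"
        using WK ZE
      proof eventually_elim
        case (elim \<omega>)
        have "H \<omega> * (f (p (W \<omega>)) (q (Z \<omega>)) - f (W \<omega>) (Z \<omega>)) \<le> 1 * e'"
          using close[OF elim] H01[of \<omega>] by (intro order_trans[OF mult_left_mono mult_right_mono]) (auto simp: abs_le_iff)
        then show ?case by (simp add: right_diff_distrib)
      qed
    qed (use int3 int1 in auto)
    also have "\<dots> = (\<integral>\<omega>. H \<omega> * f (W \<omega>) (Z \<omega>) \<partial>M) + e'" using int1 by (simp add: prob_space)
    finally show "(\<integral>\<omega>. H \<omega> * g \<omega> \<partial>M) \<le> (\<integral>\<omega>. H \<omega> * f (W \<omega>) (Z \<omega>) \<partial>M) + e" by (simp add: e'_def)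
  qed
qed

section \<open>Pointwise growth of the exponential potential\<close>

text \<open>The Lagrange remainder has even degree 4, hence is nonnegative for either sign of
  \<open>u\<close>.\<close>

lemma exp_ge_cubic: "1 + u + u\<^sup>2 / 2 + u ^ 3 / 6 \<le> exp (u::real)"
proof -
  obtain t where "exp u = (\<Sum>m<4. u ^ m / fact m) + exp t / fact 4 * u ^ 4"
    using Maclaurin_exp_le[of u 4] by blast
  moreover have "(\<Sum>m<4. u ^ m / fact m) = 1 + u + u\<^sup>2 / 2 + u ^ 3 / 6"
    by (simp add: eval_nat_numeral fact_numeral)
  moreover have "0 \<le> exp t / fact 4 * u ^ 4" by simp
  ultimately show ?thesis by linarith
qed

text \<open>With \<open>u\<close> the change of the exponent, the cubic bound leaves
  \<open>u\<close>, the square \<open>\<theta>\<^sup>2 * s\<^sup>2 / 2\<close> and an error of third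
  order in the joint displacement. The square is split by discarding
  \<open>(1 + \<eta>) * (\<alpha> - \<beta>)\<^sup>2\<close>, the powers of the displacement by
  convexity, so that no mixed term in \<open>a\<close> and \<open>b\<close> survives.\<close>

lemma exp_pursuit_increment_ge:
  fixes w a b :: "'a::real_inner" and \<theta> \<eta> E V Q :: real
  assumes w: "norm w \<le> V" and \<Delta>: "norm (a - (1 + \<eta>) *\<^sub>R b) \<le> E" and \<eta>: "0 \<le> \<eta>" "\<eta> \<le> 1" and \<theta>: "0 \<le> \<theta>"
    and Q: "Q = 32 * (\<theta>\<^sup>2 * V / 2 + (\<theta> * (V + E / 2)) ^ 3 / 6)"
  shows "increment_functional (4 * \<theta>) Q (- \<theta> *\<^sub>R w) w (- \<theta>\<^sup>2 * \<eta> / 2) a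
      + increment_functional (4 * \<theta>) Q ((\<theta> * (1 + \<eta>)) *\<^sub>R w) w (\<theta>\<^sup>2 * \<eta> * (1 + \<eta>) / 2) b
    \<le> exp (- \<theta> * (w \<bullet> (a - (1 + \<eta>) *\<^sub>R b) + (norm (a - (1 + \<eta>) *\<^sub>R b))\<^sup>2 / 2)) - 1"
proof -
  define \<Delta> where "\<Delta> = a - (1 + \<eta>) *\<^sub>R b"
  define N where "N = norm \<Delta>"
  define \<alpha> \<beta> where "\<alpha> = w \<bullet> a" and "\<beta> = w \<bullet> b"
  define s where "s = w \<bullet> \<Delta>"
  define u where "u = - \<theta> * (s + N\<^sup>2 / 2)"
  have N: "0 \<le> N" "N \<le> E" using \<Delta> by (simp_all add: N_def \<Delta>_def)
  have V: "0 \<le> V" using w norm_ge_zero order_trans by blast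
  have s: "s = \<alpha> - (1 + \<eta>) * \<beta>" by (simp add: s_def \<Delta>_def \<alpha>_def \<beta>_def inner_diff_right)
  have sV: "\<bar>s\<bar> \<le> V * N" unfolding s_def N_def by (rule abs_inner_le_mult[OF w])
  have s2: "- \<eta> * \<alpha>\<^sup>2 + \<eta> * (1 + \<eta>) * \<beta>\<^sup>2 \<le> s\<^sup>2"
  proof -
    have "s\<^sup>2 - (- \<eta> * \<alpha>\<^sup>2 + \<eta> * (1 + \<eta>) * \<beta>\<^sup>2) = (1 + \<eta>) * (\<alpha> - \<beta>)\<^sup>2"
      unfolding s by (simp add: power2_eq_square algebra_simps)
    moreover have "0 \<le> (1 + \<eta>) * (\<alpha> - \<beta>)\<^sup>2" using \<eta> by simp
    ultimately show ?thesis by linarith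
  qed
  have u2: "\<theta>\<^sup>2 * s\<^sup>2 - \<theta>\<^sup>2 * V * N ^ 3 \<le> u\<^sup>2"
  proof -
    have "- (V * N) * N\<^sup>2 \<le> s * N\<^sup>2" using sV by (intro mult_right_mono) auto
    then have "s\<^sup>2 - V * N ^ 3 \<le> s\<^sup>2 + s * N\<^sup>2 + (N\<^sup>2 / 2)\<^sup>2"
      using zero_le_power2[of "N\<^sup>2 / 2"] by (simp add: power3_eq_cube power2_eq_square mult.assoc)
    also have "\<dots> = (s + N\<^sup>2 / 2)\<^sup>2" by (simp add: power2_sum algebra_simps)
    finally have "\<theta>\<^sup>2 * (s\<^sup>2 - V * N ^ 3) \<le> \<theta>\<^sup>2 * (s + N\<^sup>2 / 2)\<^sup>2" by (intro mult_left_mono) auto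
    then show ?thesis unfolding u_def by (simp add: power_mult_distrib right_diff_distrib mult.assoc)
  qed
  have u3: "- ((\<theta> * (V + E / 2)) ^ 3 * N ^ 3) \<le> u ^ 3"
  proof -
    have "\<bar>s + N\<^sup>2 / 2\<bar> \<le> (V + E / 2) * N"
      using abs_triangle_ineq[of s "N\<^sup>2 / 2"] sV mult_right_mono[OF N(2) N(1)]
      by (simp add: power2_eq_square algebra_simps)
    then have "\<bar>u\<bar> \<le> \<theta> * ((V + E / 2) * N)" unfolding u_def using \<theta> by (simp add: abs_mult mult_left_mono)
    then have "\<bar>u\<bar> ^ 3 \<le> (\<theta> * ((V + E / 2) * N)) ^ 3" by (intro power_mono) auto
    then have "\<bar>u ^ 3\<bar> \<le> (\<theta> * (V + E / 2)) ^ 3 * N ^ 3" by (simp add: power_abs power_mult_distrib mult.assoc)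
    then show ?thesis by linarith
  qed
  define x y where "x = norm a" and "y = norm b"
  have xy: "0 \<le> x" "0 \<le> y" by (simp_all add: x_def y_def)
  have Nxy: "N \<le> x + 2 * y"
  proof -
    have "N \<le> x + (1 + \<eta>) * y"
      unfolding N_def \<Delta>_def x_def y_def using norm_triangle_ineq4[of a "(1 + \<eta>) *\<^sub>R b"] \<eta> by simp
    also have "(1 + \<eta>) * y \<le> 2 * y" using \<eta> xy by (intro mult_right_mono) auto
    finally show ?thesis by simp
  qed
  \<comment> \<open>Here and in \<open>N3\<close> the smaller coefficient is enlarged to the larger
    one, so that both particles get the same penalties \<open>A\<close> and \<open>Q\<close>.
    Halving \<open>8 * \<theta>\<close> gives \<open>A = 4 * \<theta>\<close>.\<close>
  have N2: "N\<^sup>2 \<le> 8 * x\<^sup>2 + 8 * y\<^sup>2"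
  proof -
    have "N\<^sup>2 \<le> (x + 2 * y)\<^sup>2" using Nxy N by (intro power_mono) auto
    moreover have "2 * x\<^sup>2 + 8 * y\<^sup>2 - (x + 2 * y)\<^sup>2 = (x - 2 * y)\<^sup>2" by (simp add: power2_eq_square algebra_simps)
    moreover have "0 \<le> (x - 2 * y)\<^sup>2" "0 \<le> x\<^sup>2" by auto
    ultimately show ?thesis by linarith
  qed
  have N3: "N ^ 3 \<le> 32 * x ^ 3 + 32 * y ^ 3"
  proof -
    have "N ^ 3 \<le> (x + 2 * y) ^ 3" using Nxy N by (intro power_mono) auto
    moreover have "4 * x ^ 3 + 32 * y ^ 3 - (x + 2 * y) ^ 3 = 3 * (x + 2 * y) * (x - 2 * y)\<^sup>2"
      by (simp add: eval_nat_numeral algebra_simps)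
    moreover have "0 \<le> 3 * (x + 2 * y) * (x - 2 * y)\<^sup>2" "0 \<le> x ^ 3" using xy by auto
    ultimately show ?thesis by linarith
  qed
  define q where "q = \<theta>\<^sup>2 * V / 2 + (\<theta> * (V + E / 2)) ^ 3 / 6"
  have q0: "0 \<le> q" unfolding q_def using \<theta> V N by auto
  have "u + (\<theta>\<^sup>2 * s\<^sup>2) / 2 - q * N ^ 3 \<le> u + u\<^sup>2 / 2 + u ^ 3 / 6"
    using u2 u3 by (simp add: q_def algebra_simps)
  then have main: "u + (\<theta>\<^sup>2 * s\<^sup>2) / 2 - q * N ^ 3 \<le> exp u - 1" using exp_ge_cubic[of u] by linarith
  have "\<theta>\<^sup>2 * (- \<eta> * \<alpha>\<^sup>2 + \<eta> * (1 + \<eta>) * \<beta>\<^sup>2) \<le> \<theta>\<^sup>2 * s\<^sup>2" using s2 by (intro mult_left_mono) auto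
  moreover have "q * N ^ 3 \<le> q * (32 * x ^ 3 + 32 * y ^ 3)" using N3 q0 by (rule mult_left_mono)
  moreover have "\<theta> * N\<^sup>2 \<le> \<theta> * (8 * x\<^sup>2 + 8 * y\<^sup>2)" using N2 \<theta> by (rule mult_left_mono)
  moreover have "u = - \<theta> * \<alpha> + \<theta> * (1 + \<eta>) * \<beta> - \<theta> * N\<^sup>2 / 2" by (simp add: u_def s algebra_simps)
  ultimately have "- \<theta> * \<alpha> + \<theta> * (1 + \<eta>) * \<beta> - \<theta> * (8 * x\<^sup>2 + 8 * y\<^sup>2) / 2
      + \<theta>\<^sup>2 * (- \<eta> * \<alpha>\<^sup>2 + \<eta> * (1 + \<eta>) * \<beta>\<^sup>2) / 2 - q * (32 * x ^ 3 + 32 * y ^ 3) \<le> exp u - 1"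
    using main by linarith
  moreover have "increment_functional (4 * \<theta>) Q (- \<theta> *\<^sub>R w) w (- \<theta>\<^sup>2 * \<eta> / 2) a
      = - \<theta> * \<alpha> + (- \<theta>\<^sup>2 * \<eta> / 2) * \<alpha>\<^sup>2 - 4 * \<theta> * x\<^sup>2 - 32 * q * x ^ 3"
    by (simp add: increment_functional_def Q q_def \<alpha>_def x_def)
  moreover have "increment_functional (4 * \<theta>) Q ((\<theta> * (1 + \<eta>)) *\<^sub>R w) w (\<theta>\<^sup>2 * \<eta> * (1 + \<eta>) / 2) b
      = \<theta> * (1 + \<eta>) * \<beta> + (\<theta>\<^sup>2 * \<eta> * (1 + \<eta>) / 2) * \<beta>\<^sup>2 - 4 * \<theta> * y\<^sup>2 - 32 * q * y ^ 3"
    by (simp add: increment_functional_def Q q_def \<beta>_def y_def)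
  ultimately have "increment_functional (4 * \<theta>) Q (- \<theta> *\<^sub>R w) w (- \<theta>\<^sup>2 * \<eta> / 2) a
      + increment_functional (4 * \<theta>) Q ((\<theta> * (1 + \<eta>)) *\<^sub>R w) w (\<theta>\<^sup>2 * \<eta> * (1 + \<eta>) / 2) b \<le> exp u - 1"
    by (simp add: algebra_simps add_divide_distrib diff_divide_distrib)
  then show ?thesis unfolding u_def s_def N_def \<Delta>_def .
qed

text \<open>Passing from \<open>A k\<close> to \<open>A (Suc k)\<close> loses at most the mass of
  the difference because \<Phi> is at most 1, and these losses telescope to at most 1. A positive
  limit probability would make the expectations grow linearly, though they stay in the unit
  interval.\<close>

lemma (in prob_space) decreasing_events_null_of_drift:
  fixes \<Phi> :: "nat \<Rightarrow> 'a \<Rightarrow> real"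
  assumes [measurable]: "\<And>k. A k \<in> events" and dec: "\<And>k. A (Suc k) \<subseteq> A k"
    and [measurable]: "\<And>k. \<Phi> k \<in> borel_measurable M" and \<Phi>: "\<And>k \<omega>. 0 \<le> \<Phi> k \<omega>" "\<And>k \<omega>. \<Phi> k \<omega> \<le> 1"
    and "0 < \<theta>"
    and drift: "\<And>k. expectation (\<lambda>\<omega>. indicator (A k) \<omega> * \<Phi> k \<omega>) + \<theta> * prob (A k)
      \<le> expectation (\<lambda>\<omega>. indicator (A k) \<omega> * \<Phi> (Suc k) \<omega>)"
  shows "prob (\<Inter>k. A k) = 0"
proof -
  define E where "E k = expectation (\<lambda>\<omega>. indicator (A k) \<omega> * \<Phi> k \<omega>)" for k
  have int: "integrable M (\<lambda>\<omega>. indicator (A k) \<omega> * \<Phi> j \<omega>)" for k j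
    using \<Phi> by (intro integrable_const_bound[where B = 1]) (auto simp: indicator_def)
  have intA: "integrable M (\<lambda>\<omega>. indicat_real (A k) \<omega>)" for k
    by (intro integrable_const_bound[where B = 1]) (auto simp: indicator_def)
  have step: "E k + \<theta> * prob (A k) \<le> E (Suc k) + prob (A k) - prob (A (Suc k))" for k
  proof -
    have "expectation (\<lambda>\<omega>. indicator (A k) \<omega> * \<Phi> (Suc k) \<omega>)
        \<le> expectation (\<lambda>\<omega>. indicator (A (Suc k)) \<omega> * \<Phi> (Suc k) \<omega> + indicator (A k) \<omega> - indicator (A (Suc k)) \<omega>)"
    proof (rule integral_mono)
      fix \<omega>
      show "indicator (A k) \<omega> * \<Phi> (Suc k) \<omega> \<le> indicator (A (Suc k)) \<omega> * \<Phi> (Suc k) \<omega> + indicator (A k) \<omega> - indicator (A (Suc k)) \<omega>"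
        using dec[of k] \<Phi>(1)[of "Suc k" \<omega>] \<Phi>(2)[of "Suc k" \<omega>] by (auto simp: indicator_def)
    qed (use int intA in auto)
    also have "\<dots> = E (Suc k) + prob (A k) - prob (A (Suc k))"
      unfolding E_def using int intA by simp
    finally show ?thesis using drift[of k] unfolding E_def by linarith
  qed
  have E: "0 \<le> E k" "E k \<le> 1" for k
  proof -
    show "0 \<le> E k" unfolding E_def using \<Phi> by (intro integral_nonneg_AE AE_I2) (auto simp: indicator_def)
    have "E k \<le> expectation (\<lambda>_. 1)" unfolding E_def
      using int \<Phi> by (intro integral_mono) (auto simp: indicator_def)
    then show "E k \<le> 1" by (simp add: prob_space)
  qed
  let ?p = "prob (\<Inter>k. A k)"
  have sum: "E 0 + real n * (\<theta> * ?p) \<le> E n + prob (A 0) - prob (A n)" for n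
  proof (induction n)
    case (Suc n)
    have "?p \<le> prob (A n)" by (intro finite_measure_mono) auto
    then have "\<theta> * ?p \<le> \<theta> * prob (A n)" using \<open>0 < \<theta>\<close> by simp
    then show ?case using Suc step[of n] by (simp add: algebra_simps)
  qed simp
  show ?thesis
  proof (rule ccontr)
    assume "?p \<noteq> 0"
    then have "0 < ?p" using measure_nonneg[of M "\<Inter>k. A k"] by linarith
    then have pos: "0 < \<theta> * ?p" using \<open>0 < \<theta>\<close> by simp
    \<comment> \<open>The right side of \<open>sum\<close> is at most 2: one for \<open>E n\<close>
      and one for \<open>prob (A 0)\<close>.\<close>
    then obtain n where n: "2 < real n * (\<theta> * ?p)" using ex_less_of_nat_mult by blast
    have "prob (A 0) \<le> 1" "0 \<le> prob (A n)" by auto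
    then show False using sum[of n] n E[of n] E[of 0] by linarith
  qed
qed

section \<open>The sigma-algebra of the joint past\<close>

lemma
  fixes X Y :: "real \<Rightarrow> 'w \<Rightarrow> 'a::topological_space"
  shows space_past: "space (past M X Y s) = space M"
    and measurable_past: "\<lbrakk>0 \<le> u; u \<le> s\<rbrakk> \<Longrightarrow> (\<lambda>\<omega>. (X u \<omega>, Y u \<omega>)) \<in> borel_measurable (past M X Y s)"
proof -
  show sp: "space (past M X Y s) = space M" unfolding past_def by (intro space_measure_of) auto
  show "(\<lambda>\<omega>. (X u \<omega>, Y u \<omega>)) \<in> borel_measurable (past M X Y s)" if "0 \<le> u" "u \<le> s"
  proof (rule measurableI)
    fix A :: "('a \<times> 'a) set" assume "A \<in> sets borel"
    then show "(\<lambda>\<omega>. (X u \<omega>, Y u \<omega>)) -` A \<inter> space (past M X Y s) \<in> sets (past M X Y s)"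
      unfolding sp unfolding past_def using that
      by (subst sets_measure_of) (auto intro!: sigma_sets.Basic)
  qed auto
qed

lemma subalgebra_past:
  fixes X Y :: "real \<Rightarrow> 'w \<Rightarrow> 'a::{second_countable_topology, topological_space}"
  assumes [measurable]: "\<And>t. X t \<in> borel_measurable M" "\<And>t. Y t \<in> borel_measurable M"
  shows "subalgebra M (past M X Y s)"
  unfolding subalgebra_def
proof
  show "space (past M X Y s) = space M" by (rule space_past)
  have "(\<lambda>\<omega>. (X u \<omega>, Y u \<omega>)) \<in> borel_measurable M" for u by measurable
  then show "sets (past M X Y s) \<subseteq> sets M"
    unfolding past_def by (subst sets_measure_of) (auto intro!: sets.sigma_sets_subset measurable_sets)
qed

lemma reflected_bm_AE_closure:
  assumes "reflected_bm D \<nu> M x X"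
  shows "AE \<omega> in M. \<forall>t\<ge>0. X t \<omega> \<in> closure D"
  using assms unfolding reflected_bm_def by (elim conjE exE, elim eventually_mono) blast

theorem theorem3p1:
  fixes D :: "(real^'n) set"
    and \<nu> :: "real^'n \<Rightarrow> real^'n"
    and M :: "real^'n \<Rightarrow> real^'n \<Rightarrow> 'w measure"
    and X Y :: "real^'n \<Rightarrow> real^'n \<Rightarrow> real \<Rightarrow> 'w \<Rightarrow> real^'n"
    and P :: "real^'n \<Rightarrow> real \<Rightarrow> (real^'n) measure"
  assumes "open D" and "bounded D" and "convex D" and "D \<noteq> {}"
    and "\<forall>a b. a \<noteq> b \<longrightarrow> \<not> closed_segment a b \<subseteq> frontier D"
    and "\<nu> \<in> borel_measurable borel"
    and "\<forall>x\<in>frontier D. norm (\<nu> x) = 1 \<and> (\<forall>y\<in>closure D. 0 \<le> (y - x) \<bullet> \<nu> x)"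
    and "\<forall>x0\<in>closure D. \<forall>y0\<in>closure D.
           prob_space (M x0 y0) \<and>
           reflected_bm D \<nu> (M x0 y0) x0 (X x0 y0) \<and>
           reflected_bm D \<nu> (M x0 y0) y0 (Y x0 y0) \<and>
           (\<forall>t\<ge>0. distr (M x0 y0) borel (X x0 y0 t) = P x0 t \<and>
                   distr (M x0 y0) borel (Y x0 y0 t) = P y0 t) \<and>
           co_adapted (M x0 y0) (X x0 y0) (Y x0 y0) P"
    and "x0 \<in> closure D" and "y0 \<in> closure D" and "x0 \<noteq> y0" and "(\<epsilon>::real) > 0"
  shows "AE \<omega> in M x0 y0. \<exists>t\<ge>0. norm (X x0 y0 t \<omega> - Y x0 y0 t \<omega>) \<le> \<epsilon>"
proof -

  \<comment> \<open>Constants: geometry first, then the exponent, then the time step\<close>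
  note nun = assms(7) and cpl = assms(8)
  obtain R0 where R0: "\<And>x. x \<in> closure D \<Longrightarrow> norm x \<le> R0"
    using bounded_closure[OF assms(2)] unfolding bounded_iff by blast
  define R where "R = max 1 R0"
  have R: "0 < R" and Rc: "\<And>x. x \<in> closure D \<Longrightarrow> norm x \<le> R"
    using R0 unfolding R_def by (auto simp: le_max_iff_disj)
  obtain z r where r: "0 < r" and zr: "ball z r \<subseteq> D"
    using \<open>open D\<close> \<open>D \<noteq> {}\<close> open_contains_ball by blast
  have e2: "0 < \<epsilon> / 2" using \<open>\<epsilon> > 0\<close> by simp
  \<comment> \<open>Separation \<open>\<epsilon> / 2\<close> rather than \<epsilon>, because the
    frontier point hit may differ from the particle's position at the start of the step by \<rho>,
    at most \<open>\<epsilon> / 2\<close>.\<close>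
  obtain c where c: "0 < c"
    and cin: "\<And>u y. \<lbrakk>u \<in> frontier D; y \<in> closure D; \<epsilon> / 2 \<le> norm (u - y)\<rbrakk> \<Longrightarrow> c \<le> (y - u) \<bullet> \<nu> u"
    using strict_inward_normal[OF assms(1-3,5) nun e2] by blast
  \<comment> \<open>The shift \<open>\<eta> *\<^sub>R y\<close> separating \<open>w\<close> from
    \<open>x - y\<close> must cost at most \<open>c / 4\<close> in the push estimates and at most
    \<open>\<epsilon> / 2\<close> in the length of \<open>w\<close>.\<close>
  define \<eta> where "\<eta> = min 1 (min (c / (4 * R)) (\<epsilon> / (2 * R)))"
  have \<eta>0: "0 < \<eta>" and \<eta>1: "\<eta> \<le> 1" and "\<eta> \<le> c / (4 * R)" "\<eta> \<le> \<epsilon> / (2 * R)"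
    using c R \<open>\<epsilon> > 0\<close> by (auto simp: \<eta>_def)
  then have \<eta>c: "\<eta> * R \<le> c / 4" and \<eta>\<epsilon>: "\<eta> * R \<le> \<epsilon> / 2" using R by (simp_all add: field_simps)
  define \<rho> where "\<rho> = min (\<epsilon> / 2) (c / 4)"
  have \<rho>: "0 < \<rho>" "\<rho> \<le> \<epsilon> / 2" "\<rho> \<le> c / 4" using c e2 by (auto simp: \<rho>_def)
  define w where "w p = fst p - (1 + \<eta>) *\<^sub>R snd p" for p :: "(real^'n) \<times> (real^'n)"
  have yR: "norm (\<eta> *\<^sub>R y) \<le> \<eta> * R" if "y \<in> closure D" for y using Rc[OF that] \<eta>0 by simp
  have w3: "norm (w (x, y)) \<le> 3 * R" if "x \<in> closure D" "y \<in> closure D" for x y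
  proof -
    have "norm (w (x, y)) \<le> norm x + (1 + \<eta>) * norm y"
      unfolding w_def using norm_triangle_ineq4[of x "(1 + \<eta>) *\<^sub>R y"] \<eta>0 by simp
    also have "\<dots> \<le> R + 2 * R" using Rc that \<eta>0 \<eta>1 by (intro add_mono mult_mono) auto
    finally show ?thesis by simp
  qed
  have weps: "\<epsilon> / 2 \<le> norm (w (x, y))" if "x \<in> closure D" "y \<in> closure D" "\<epsilon> < norm (x - y)" for x y
  proof -
    have "norm (x - y) \<le> norm (w (x, y)) + norm (\<eta> *\<^sub>R y)"
      using norm_triangle_ineq[of "w (x, y)" "\<eta> *\<^sub>R y"] by (simp add: w_def algebra_simps)
    then show ?thesis using yR[OF that(2)] that \<eta>\<epsilon> by linarith
  qed
  \<comment> \<open>Reflection of either particle shortens \<open>w\<close>: of the margin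
    \<open>c\<close>, one quarter pays for the distance \<rho> to the frontier point and one quarter
    for the shift by \<open>\<eta> *\<^sub>R y\<close>. The fact \<open>pull\<close> does the same
    for the second particle.\<close>
  have push: "c / 2 \<le> - (w (x, y) \<bullet> \<nu> u)"
    if "x \<in> closure D" "y \<in> closure D" "\<epsilon> < norm (x - y)" "u \<in> frontier D" "norm (u - x) \<le> \<rho>" for x y u
  proof -
    have n1: "norm (\<nu> u) = 1" using nun that by auto
    have "norm (x - y) \<le> norm (u - x) + norm (u - y)" using norm_triangle_ineq4[of "u - y" "u - x"] by simp
    then have "c \<le> (y - u) \<bullet> \<nu> u" using cin that \<rho> by auto
    moreover have "- \<rho> \<le> (u - x) \<bullet> \<nu> u" using Cauchy_Schwarz_ineq2[of "u - x" "\<nu> u"] n1 that by auto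
    moreover have "- (\<eta> * R) \<le> (\<eta> *\<^sub>R y) \<bullet> \<nu> u" using Cauchy_Schwarz_ineq2[of "\<eta> *\<^sub>R y" "\<nu> u"] yR[OF that(2)] unfolding n1 mult_1_right by linarith
    moreover have "- (w (x, y) \<bullet> \<nu> u) = (y - u) \<bullet> \<nu> u + (u - x) \<bullet> \<nu> u + (\<eta> *\<^sub>R y) \<bullet> \<nu> u"
      by (simp add: w_def inner_diff_left inner_add_left algebra_simps)
    ultimately show "c / 2 \<le> - (w (x, y) \<bullet> \<nu> u)" using \<rho>(3) \<eta>c by linarith
  qed
  have pull: "c / 2 \<le> w (x, y) \<bullet> \<nu> u"
    if "x \<in> closure D" "y \<in> closure D" "\<epsilon> < norm (x - y)" "u \<in> frontier D" "norm (u - y) \<le> \<rho>" for x y u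
  proof -
    have n1: "norm (\<nu> u) = 1" using nun that by auto
    have "norm (x - y) \<le> norm (u - x) + norm (u - y)" using norm_triangle_ineq4[of "u - y" "u - x"] by simp
    then have "c \<le> (x - u) \<bullet> \<nu> u" using cin that \<rho> by auto
    moreover have "- \<rho> \<le> (u - y) \<bullet> \<nu> u" using Cauchy_Schwarz_ineq2[of "u - y" "\<nu> u"] n1 that by auto
    moreover have "(\<eta> *\<^sub>R y) \<bullet> \<nu> u \<le> \<eta> * R" using Cauchy_Schwarz_ineq2[of "\<eta> *\<^sub>R y" "\<nu> u"] yR[OF that(2)] unfolding n1 mult_1_right by linarith
    moreover have "w (x, y) \<bullet> \<nu> u = (x - u) \<bullet> \<nu> u + (u - y) \<bullet> \<nu> u - (\<eta> *\<^sub>R y) \<bullet> \<nu> u"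
      by (simp add: w_def inner_diff_left inner_add_left algebra_simps)
    ultimately show ?thesis using \<rho>(3) \<eta>c by linarith
  qed
  define n where "n = real CARD('n)"
  \<comment> \<open>The gain
    \<open>\<theta>\<^sup>2 * \<eta>\<^sup>2 / 2 * (norm w)\<^sup>2\<close>, with
    \<open>norm w\<close> at least \<open>\<epsilon> / 2\<close>, has to exceed the Laplacian loss
    \<open>8 * \<theta> * n\<close> of both particles by 2.\<close>
  define \<theta> where "\<theta> = max 1 (8 * (8 * n + 2) / (\<eta> * \<epsilon>)\<^sup>2)"
  have \<theta>1: "1 \<le> \<theta>" by (simp add: \<theta>_def)
  have \<theta>2: "2 \<le> \<theta> * (\<eta> * \<epsilon>)\<^sup>2 / 8 - 8 * n"
  proof -
    have "0 < (\<eta> * \<epsilon>)\<^sup>2" using \<eta>0 \<open>\<epsilon> > 0\<close> by simp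
    moreover have "8 * (8 * n + 2) / (\<eta> * \<epsilon>)\<^sup>2 \<le> \<theta>" by (simp add: \<theta>_def)
    ultimately have "8 * (8 * n + 2) \<le> \<theta> * (\<eta> * \<epsilon>)\<^sup>2" by (simp add: pos_divide_le_eq)
    then show ?thesis by simp
  qed
  \<comment> \<open>The cubic penalty of \<open>exp_pursuit_increment_ge\<close> with
    \<open>V = 3 * R\<close> bounding \<open>w\<close> and \<open>E = 6 * R\<close> bounding its
    increment.\<close>
  define Q where "Q = 32 * (\<theta>\<^sup>2 * (3 * R) / 2 + (\<theta> * (3 * R + 6 * R / 2)) ^ 3 / 6)"
  have Q0: "0 \<le> Q" using \<theta>1 R by (simp add: Q_def)
  define \<sigma>1 \<sigma>2 where "\<sigma>1 = - \<theta>\<^sup>2 * \<eta> / 2" and "\<sigma>2 = \<theta>\<^sup>2 * \<eta> * (1 + \<eta>) / 2"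
  define \<Lambda> where "\<Lambda> = 2 * \<theta> * (3 * R) + 3 * R + \<theta>\<^sup>2"
  have \<Lambda>0: "0 \<le> \<Lambda>" using \<theta>1 R by (simp add: \<Lambda>_def)
  have c2: "0 < \<theta> * c / 2" using \<theta>1 c by simp
  have cball: "closure D \<subseteq> cball 0 R" using Rc by auto
  have A0: "0 \<le> 4 * \<theta>" using \<theta>1 by simp
  \<comment> \<open>One step \<open>h\<close> for all starting points, with allowance
    \<open>\<kappa> = 1/2\<close> per particle.\<close>
  obtain h where h: "0 < h" and incr: "\<And>(N :: 'w measure) x X' l m \<sigma>.
      \<lbrakk>reflected_bm D \<nu> N x X'; x \<in> closure D; norm l \<le> \<Lambda>; norm m \<le> \<Lambda>; \<bar>\<sigma>\<bar> \<le> \<Lambda>;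
       \<And>u. \<lbrakk>u \<in> frontier D; norm (u - x) \<le> \<rho>\<rbrakk> \<Longrightarrow> \<theta> * c / 2 \<le> l \<bullet> \<nu> u\<rbrakk> \<Longrightarrow>
      (\<sigma> * (norm m)\<^sup>2 - 4 * \<theta> * n - 1 / 2) * h \<le> (\<integral>\<omega>. increment_functional (4 * \<theta>) Q l m \<sigma> (X' h \<omega> - x) \<partial>N)"
    using reflected_bm_increment_functional_ge[where 'w = 'w and \<kappa> = "1/2", OF assms(1) cball zr r assms(6) nun c2 \<rho>(1) \<Lambda>0 A0 Q0]
    unfolding n_def by (auto 4 4)

  \<comment> \<open>The transition kernel over one time step\<close>
  \<comment> \<open>The kernel from an arbitrary \<open>x\<close> is realised by a reflected
    Brownian motion taken from the coupling with both starting points equal to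
    \<open>x\<close>.\<close>
  have kern: "P x h = distr (M x x) borel (X x x h)" "X x x h \<in> borel_measurable (M x x)"
      "reflected_bm D \<nu> (M x x) x (X x x)" "prob_space (M x x)" if "x \<in> closure D" for x
  proof -
    show "reflected_bm D \<nu> (M x x) x (X x x)" "prob_space (M x x)" using cpl that by blast+
    then show "X x x h \<in> borel_measurable (M x x)" unfolding reflected_bm_def by blast
    have "\<forall>t\<ge>0. distr (M x x) borel (X x x t) = P x t" using cpl that by blast
    then show "P x h = distr (M x x) borel (X x x h)" using h by simp
  qed
  have kprob: "prob_space (P x h) \<and> sets (P x h) = sets borel \<and> (AE u in P x h. u \<in> closure D)" if "x \<in> closure D" for x
  proof -
    interpret prob_space "M x x" by (rule kern(4)[OF that])
    have "AE \<omega> in M x x. X x x h \<omega> \<in> closure D"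
      using reflected_bm_AE_closure[OF kern(3)[OF that]] h by (auto elim!: eventually_mono)
    then show ?thesis
      unfolding kern(1)[OF that] using kern(2)[OF that]
      by (auto simp: AE_distr_iff intro!: prob_space_distr)
  qed
  have low: "(\<sigma> * (norm m)\<^sup>2 - 4 * \<theta> * n - 1 / 2) * h \<le> (\<integral>u. increment_functional (4 * \<theta>) Q l m \<sigma> (u - x) \<partial>P x h)"
    if "x \<in> closure D" "norm l \<le> \<Lambda>" "norm m \<le> \<Lambda>" "\<bar>\<sigma>\<bar> \<le> \<Lambda>"
      "\<And>u. \<lbrakk>u \<in> frontier D; norm (u - x) \<le> \<rho>\<rbrakk> \<Longrightarrow> \<theta> * c / 2 \<le> l \<bullet> \<nu> u" for x l m \<sigma>
  proof -
    have "(\<lambda>u. increment_functional (4 * \<theta>) Q l m \<sigma> (u - x)) \<in> borel_measurable borel"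
      unfolding increment_functional_def by measurable
    then show ?thesis
      using incr[OF kern(3)[OF that(1)] that] unfolding kern(1)[OF that(1)]
      by (subst integral_distr[OF kern(2)[OF that(1)]]) auto
  qed

  \<comment> \<open>The potential along the time grid\<close>
  define N XX YY where "N = M x0 y0" and "XX = X x0 y0" and "YY = Y x0 y0"
  interpret prob_space N using cpl assms(9,10) by (simp add: N_def)
  have rbmX: "reflected_bm D \<nu> N x0 XX" and rbmY: "reflected_bm D \<nu> N y0 YY" and coad: "co_adapted N XX YY P"
    using cpl assms(9,10) by (auto simp: N_def XX_def YY_def)
  have XM[measurable]: "XX t \<in> borel_measurable N" and YM[measurable]: "YY t \<in> borel_measurable N" for t
    using rbmX rbmY unfolding reflected_bm_def by auto
  have cl: "AE \<omega> in N. \<forall>t\<ge>0. XX t \<omega> \<in> closure D \<and> YY t \<omega> \<in> closure D"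
    using reflected_bm_AE_closure[OF rbmX] reflected_bm_AE_closure[OF rbmY] by eventually_elim auto
  \<comment> \<open>Separation is recorded at grid times only; a failure at one grid time already
    gives the required \<open>t\<close>.\<close>
  define S where "S k = {\<omega> \<in> space N. \<forall>j\<le>k. \<epsilon> < norm (XX (real j * h) \<omega> - YY (real j * h) \<omega>)}" for k :: nat
  define Z where "Z k \<omega> = (XX (real k * h) \<omega>, YY (real k * h) \<omega>)" for k :: nat and \<omega>
  define \<Phi> where "\<Phi> k \<omega> = exp (- \<theta> * (norm (w (Z k \<omega>)))\<^sup>2 / 2)" for k \<omega>
  have w_cont: "continuous_on UNIV w" unfolding w_def by (intro continuous_intros)
  have [measurable]: "w \<in> borel_measurable borel" by (rule borel_measurable_continuous_onI[OF w_cont])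
  have [measurable]: "Z k \<in> borel_measurable N" for k unfolding Z_def by measurable
  have [measurable]: "\<Phi> k \<in> borel_measurable N" for k unfolding \<Phi>_def by measurable
  have [measurable]: "S k \<in> events" for k unfolding S_def by measurable
  have \<Phi>01: "0 \<le> \<Phi> k \<omega>" "\<Phi> k \<omega> \<le> 1" for k \<omega> unfolding \<Phi>_def using \<theta>1 by auto
  have Zc: "AE \<omega> in N. \<forall>k. Z k \<omega> \<in> closure D \<times> closure D"
    using cl by eventually_elim (use h in \<open>auto simp: Z_def\<close>)
  \<comment> \<open>The least value the potential can take, as \<open>norm w\<close> is at most
    \<open>3 * R\<close>; it makes the drift uniform.\<close>
  define \<phi> where "\<phi> = exp (- \<theta> * (3 * R)\<^sup>2 / 2)"
  have drift: "expectation (\<lambda>\<omega>. indicator (S k) \<omega> * \<Phi> k \<omega>) + \<phi> * h * prob (S k)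
      \<le> expectation (\<lambda>\<omega>. indicator (S k) \<omega> * \<Phi> (Suc k) \<omega>)" for k
  proof -
    define s where "s = real k * h"
    have s: "0 \<le> s" using h by (simp add: s_def)
    have sh: "real (Suc k) * h = s + h" by (simp add: s_def algebra_simps)
    define F where "F = past N XX YY s"
    have sub: "subalgebra N F" unfolding F_def by (rule subalgebra_past[OF XM YM])
    have ZF: "Z j \<in> borel_measurable F" if "j \<le> k" for j
      unfolding Z_def F_def by (rule measurable_past) (use that h in \<open>auto simp: s_def\<close>)
    have [measurable]: "Z k \<in> borel_measurable F" by (rule ZF) simp
    have SF: "S k \<in> sets F"
    proof -
      have "S k = {\<omega> \<in> space F. \<forall>j\<in>{..k}. \<epsilon> < norm (fst (Z j \<omega>) - snd (Z j \<omega>))}"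
        unfolding S_def Z_def F_def space_past by auto
      also have "\<dots> \<in> sets F"
      proof (rule sets.sets_Collect_finite_All')
        fix j assume "j \<in> {..k}"
        then have [measurable]: "Z j \<in> borel_measurable F" using ZF by simp
        have "continuous_on UNIV (\<lambda>p::(real^'n)\<times>(real^'n). norm (fst p - snd p))" by (intro continuous_intros)
        then have [measurable]: "(\<lambda>p::(real^'n)\<times>(real^'n). norm (fst p - snd p)) \<in> borel_measurable borel"
          by (rule borel_measurable_continuous_onI)
        show "{\<omega> \<in> space F. \<epsilon> < norm (fst (Z j \<omega>) - snd (Z j \<omega>))} \<in> sets F"
          by measurable
      qed auto
      finally show ?thesis .
    qed
    \<comment> \<open>The potential changes by a factor, so its present value belongs to the weight
      that is known at time \<open>s\<close>.\<close>
    define H where "H \<omega> = indicator (S k) \<omega> * \<Phi> k \<omega>" for \<omega>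
    have HF: "H \<in> borel_measurable F" unfolding H_def \<Phi>_def using SF by measurable
    have H01: "0 \<le> H \<omega>" "H \<omega> \<le> 1" for \<omega> using \<Phi>01[of k \<omega>] by (auto simp: H_def indicator_def)
    have [measurable]: "H \<in> borel_measurable N" by (rule measurable_from_subalg[OF sub HF])
    \<comment> \<open>The two functions depend on the pair at time \<open>s\<close> and on the next
      position of one particle each, which is the form co-adaptedness can handle.\<close>
    define f1 where "f1 p u = increment_functional (4 * \<theta>) Q (- \<theta> *\<^sub>R w p) (w p) \<sigma>1 (u - fst p)"
      for p :: "(real^'n) \<times> (real^'n)" and u
    define f2 where "f2 p u = increment_functional (4 * \<theta>) Q ((\<theta> * (1 + \<eta>)) *\<^sub>R w p) (w p) \<sigma>2 (u - snd p)"
      for p :: "(real^'n) \<times> (real^'n)" and u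
    have f1c: "continuous_on UNIV (\<lambda>q. f1 (fst q) (snd q))" and f2c: "continuous_on UNIV (\<lambda>q. f2 (fst q) (snd q))"
      unfolding f1_def f2_def increment_functional_def w_def by (intro continuous_intros)+
    define g where "g \<sigma> \<omega> = (\<sigma> * (norm (w (Z k \<omega>)))\<^sup>2 - 4 * \<theta> * n - 1 / 2) * h" for \<sigma> \<omega>
    have Zk: "AE \<omega> in N. Z k \<omega> \<in> closure D \<times> closure D" using Zc by eventually_elim blast
    have Hg: "integrable N (\<lambda>\<omega>. H \<omega> * g \<sigma> \<omega>)" for \<sigma>
    proof (rule integrable_const_bound[where B = "(\<bar>\<sigma>\<bar> * (3 * R)\<^sup>2 + 4 * \<theta> * n + 1 / 2) * h"])
      show "AE \<omega> in N. norm (H \<omega> * g \<sigma> \<omega>) \<le> (\<bar>\<sigma>\<bar> * (3 * R)\<^sup>2 + 4 * \<theta> * n + 1 / 2) * h"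
        using Zk
      proof eventually_elim
        case (elim \<omega>)
        then have "norm (w (Z k \<omega>)) \<le> 3 * R" using w3 by (metis mem_Sigma_iff prod.collapse)
        then have "\<bar>\<sigma>\<bar> * (norm (w (Z k \<omega>)))\<^sup>2 \<le> \<bar>\<sigma>\<bar> * (3 * R)\<^sup>2" by (intro mult_left_mono power_mono) auto
        then have "\<bar>\<sigma> * (norm (w (Z k \<omega>)))\<^sup>2\<bar> \<le> \<bar>\<sigma>\<bar> * (3 * R)\<^sup>2" by (simp add: abs_mult)
        moreover have "0 \<le> 4 * \<theta> * n" using \<theta>1 by (simp add: n_def)
        ultimately have "\<bar>\<sigma> * (norm (w (Z k \<omega>)))\<^sup>2 - 4 * \<theta> * n - 1 / 2\<bar> \<le> \<bar>\<sigma>\<bar> * (3 * R)\<^sup>2 + 4 * \<theta> * n + 1 / 2"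
          by linarith
        then have "\<bar>g \<sigma> \<omega>\<bar> \<le> (\<bar>\<sigma>\<bar> * (3 * R)\<^sup>2 + 4 * \<theta> * n + 1 / 2) * h"
          unfolding g_def abs_mult using h by (simp add: mult_right_mono)
        then have "\<bar>H \<omega>\<bar> * \<bar>g \<sigma> \<omega>\<bar> \<le> 1 * ((\<bar>\<sigma>\<bar> * (3 * R)\<^sup>2 + 4 * \<theta> * n + 1 / 2) * h)"
          using H01 by (intro mult_mono) auto
        then show ?case by (simp add: abs_mult)
      qed
      show "(\<lambda>\<omega>. H \<omega> * g \<sigma> \<omega>) \<in> borel_measurable N" unfolding g_def by measurable
    qed
    have HS: "H \<omega> \<noteq> 0 \<Longrightarrow> \<epsilon> < norm (fst (Z k \<omega>) - snd (Z k \<omega>))" for \<omega>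
      by (auto simp: H_def S_def Z_def indicator_def split: if_splits)
    have wfs: "norm (w p) \<le> 3 * R" "norm (- \<theta> *\<^sub>R w p) \<le> \<Lambda>" "norm ((\<theta> * (1 + \<eta>)) *\<^sub>R w p) \<le> \<Lambda>" "norm (w p) \<le> \<Lambda>"
      if "p \<in> closure D \<times> closure D" for p
    proof -
      show w: "norm (w p) \<le> 3 * R" using that w3 by (metis mem_Sigma_iff prod.collapse)
      have "\<theta> * norm (w p) \<le> \<theta> * (3 * R)" using w \<theta>1 by (intro mult_left_mono) auto
      then show "norm (- \<theta> *\<^sub>R w p) \<le> \<Lambda>" using \<theta>1 R mult_nonneg_nonneg[of \<theta> R] by (simp add: \<Lambda>_def add_increasing2)
      have "(\<theta> * (1 + \<eta>)) * norm (w p) \<le> (\<theta> * 2) * (3 * R)"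
        using w \<theta>1 \<eta>0 \<eta>1 R by (intro mult_mono) auto
      then show "norm ((\<theta> * (1 + \<eta>)) *\<^sub>R w p) \<le> \<Lambda>" using \<theta>1 \<eta>0 R by (simp add: \<Lambda>_def add_increasing2)
      show "norm (w p) \<le> \<Lambda>" using w \<theta>1 R by (simp add: \<Lambda>_def add_increasing add_increasing2)
    qed
    have \<sigma>\<Lambda>: "\<bar>\<sigma>1\<bar> \<le> \<Lambda>" "\<bar>\<sigma>2\<bar> \<le> \<Lambda>"
    proof -
      have "\<theta>\<^sup>2 * \<eta> \<le> \<theta>\<^sup>2 * 1" "\<theta>\<^sup>2 * (\<eta> * (1 + \<eta>)) \<le> \<theta>\<^sup>2 * (1 * 2)"
        using \<eta>0 \<eta>1 by (intro mult_left_mono mult_mono; simp)+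
      moreover have "0 \<le> \<theta>\<^sup>2 * \<eta>" "0 \<le> \<theta>\<^sup>2 * (\<eta> * (1 + \<eta>))" "0 \<le> \<theta> * R" using \<eta>0 \<theta>1 R by auto
      ultimately show "\<bar>\<sigma>1\<bar> \<le> \<Lambda>" "\<bar>\<sigma>2\<bar> \<le> \<Lambda>"
        using R by (simp_all add: \<sigma>1_def \<sigma>2_def \<Lambda>_def abs_if mult.assoc)
    qed
    have low1: "AE \<omega> in N. H \<omega> \<noteq> 0 \<longrightarrow> g \<sigma>1 \<omega> \<le> (\<integral>u. f1 (Z k \<omega>) u \<partial>P (XX s \<omega>) h)"
      using Zk
    proof eventually_elim
      case (elim \<omega>)
      show ?case
      proof
        assume "H \<omega> \<noteq> 0"
        note e = HS[OF this]
        have z: "fst (Z k \<omega>) = XX s \<omega>" by (simp add: Z_def s_def)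
        have "\<theta> * c / 2 \<le> (- \<theta> *\<^sub>R w (Z k \<omega>)) \<bullet> \<nu> u" if "u \<in> frontier D" "norm (u - XX s \<omega>) \<le> \<rho>" for u
        proof -
          have "c / 2 \<le> - (w (Z k \<omega>) \<bullet> \<nu> u)"
            using push[of "fst (Z k \<omega>)" "snd (Z k \<omega>)" u] elim e that z by auto
          from mult_left_mono[OF this, of \<theta>] show ?thesis using \<theta>1 by simp
        qed
        then show "g \<sigma>1 \<omega> \<le> (\<integral>u. f1 (Z k \<omega>) u \<partial>P (XX s \<omega>) h)"
          unfolding g_def f1_def z using elim z wfs[OF elim] \<sigma>\<Lambda> by (intro low) auto
      qed
    qed
    have low2: "AE \<omega> in N. H \<omega> \<noteq> 0 \<longrightarrow> g \<sigma>2 \<omega> \<le> (\<integral>u. f2 (Z k \<omega>) u \<partial>P (YY s \<omega>) h)"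
      using Zk
    proof eventually_elim
      case (elim \<omega>)
      show ?case
      proof
        assume "H \<omega> \<noteq> 0"
        note e = HS[OF this]
        have z: "snd (Z k \<omega>) = YY s \<omega>" by (simp add: Z_def s_def)
        have "\<theta> * c / 2 \<le> ((\<theta> * (1 + \<eta>)) *\<^sub>R w (Z k \<omega>)) \<bullet> \<nu> u" if "u \<in> frontier D" "norm (u - YY s \<omega>) \<le> \<rho>" for u
        proof -
          have p: "c / 2 \<le> w (Z k \<omega>) \<bullet> \<nu> u"
            using pull[of "fst (Z k \<omega>)" "snd (Z k \<omega>)" u] elim e that z by auto
          \<comment> \<open>The second particle's gradient carries the factor
            \<open>1 + \<eta>\<close>, at least 1, so the same inward margin serves both.\<close>
          have "\<theta> * 1 * (c / 2) \<le> \<theta> * (1 + \<eta>) * (w (Z k \<omega>) \<bullet> \<nu> u)"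
            using p \<theta>1 \<eta>0 c by (intro mult_mono) auto
          then show ?thesis by simp
        qed
        then show "g \<sigma>2 \<omega> \<le> (\<integral>u. f2 (Z k \<omega>) u \<partial>P (YY s \<omega>) h)"
          unfolding g_def f2_def z using elim z wfs[OF elim] \<sigma>\<Lambda> by (intro low) auto
      qed
    qed
    have cD: "compact (closure D)" "compact (closure D \<times> closure D)"
      using \<open>bounded D\<close> by (auto intro: compact_Times)
    have shc: "AE \<omega> in N. XX (s + h) \<omega> \<in> closure D" "AE \<omega> in N. YY (s + h) \<omega> \<in> closure D"
      using cl by (eventually_elim, use s h in simp)+
    have kk: "AE \<omega> in N. prob_space (P (XX s \<omega>) h) \<and> sets (P (XX s \<omega>) h) = sets borel \<and> (AE u in P (XX s \<omega>) h. u \<in> closure D)"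
        "AE \<omega> in N. prob_space (P (YY s \<omega>) h) \<and> sets (P (YY s \<omega>) h) = sets borel \<and> (AE u in P (YY s \<omega>) h. u \<in> closure D)"
      using cl by (eventually_elim, use s kprob in blast)+
    have co: "AE \<omega> in N. real_cond_exp N F (indicator {\<eta> \<in> space N. XX (s + h) \<eta> \<in> A}) \<omega> = measure (P (XX s \<omega>) h) A"
        "AE \<omega> in N. real_cond_exp N F (indicator {\<eta> \<in> space N. YY (s + h) \<eta> \<in> A}) \<omega> = measure (P (YY s \<omega>) h) A"
      if A: "A \<in> sets borel" for A
    proof -
      have "0 \<le> s \<and> 0 \<le> h \<and> A \<in> sets borel" using s h A by simp
      note ca = coad[unfolded co_adapted_def, THEN spec, THEN spec, THEN spec, THEN mp, OF this, folded F_def]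
      show "AE \<omega> in N. real_cond_exp N F (indicator {\<eta> \<in> space N. XX (s + h) \<eta> \<in> A}) \<omega> = measure (P (XX s \<omega>) h) A"
        by (rule ca[THEN conjunct1])
      show "AE \<omega> in N. real_cond_exp N F (indicator {\<eta> \<in> space N. YY (s + h) \<eta> \<in> A}) \<omega> = measure (P (YY s \<omega>) h) A"
        by (rule ca[THEN conjunct2])
    qed
    note fr1 = cond_kernel_integral_ge[OF prob_space_axioms sub \<open>Z k \<in> borel_measurable F\<close> XM cD(2,1) Zk shc(1) kk(1)
        co(1) f1c HF H01 Hg low1]
    note fr2 = cond_kernel_integral_ge[OF prob_space_axioms sub \<open>Z k \<in> borel_measurable F\<close> YM cD(2,1) Zk shc(2) kk(2)
        co(2) f2c HF H01 Hg low2]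
    have i\<Phi>: "integrable N (\<lambda>\<omega>. indicator (S k) \<omega> * \<Phi> j \<omega>)" for j
      using \<Phi>01 by (intro integrable_const_bound[where B = 1]) (auto simp: indicator_def)
    have iS: "integrable N (\<lambda>\<omega>. indicat_real (S k) \<omega>)"
      by (intro integrable_const_bound[where B = 1]) (auto simp: indicator_def)
    \<comment> \<open>The chain runs from the uniform drift to the conditional bounds
      \<open>g\<close>, then by co-adaptedness to the next positions, and finally to the true
      increment of \<Phi>.\<close>
    have "\<phi> * h * prob (S k) = expectation (\<lambda>\<omega>. \<phi> * h * indicator (S k) \<omega>)" by simp
    also have "\<dots> \<le> expectation (\<lambda>\<omega>. H \<omega> * g \<sigma>1 \<omega> + H \<omega> * g \<sigma>2 \<omega>)"
    proof (rule integral_mono_AE)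
      show "AE \<omega> in N. \<phi> * h * indicator (S k) \<omega> \<le> H \<omega> * g \<sigma>1 \<omega> + H \<omega> * g \<sigma>2 \<omega>"
        using Zk
      proof eventually_elim
        case (elim \<omega>)
        show ?case
        proof (cases "\<omega> \<in> S k")
          case True
          define a where "a = norm (w (Z k \<omega>))"
          have "\<epsilon> < norm (fst (Z k \<omega>) - snd (Z k \<omega>))" using True by (auto simp: S_def Z_def)
          then have a: "\<epsilon> / 2 \<le> a" "a \<le> 3 * R"
            using weps[of "fst (Z k \<omega>)" "snd (Z k \<omega>)"] elim wfs(1)[OF elim] by (auto simp: a_def)
          have "(\<epsilon> / 2)\<^sup>2 \<le> a\<^sup>2" "a\<^sup>2 \<le> (3 * R)\<^sup>2" using a \<open>\<epsilon> > 0\<close> by (intro power_mono; linarith)+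
          then have \<phi>: "\<phi> \<le> \<Phi> k \<omega>" unfolding \<phi>_def \<Phi>_def a_def[symmetric] using \<theta>1 by (simp add: mult_left_mono)
          \<comment> \<open>The coefficients \<sigma>1 and \<sigma>2 add up to
            \<open>\<theta>\<^sup>2 * \<eta>\<^sup>2 / 2\<close>: the first-order parts in \<eta>
            cancel. Of the surplus 2, the two allowances of \<open>1/2\<close> use up 1.\<close>
          have "1 * 2 \<le> \<theta> * (\<theta> * (\<eta> * \<epsilon>)\<^sup>2 / 8 - 8 * n)" using \<theta>1 \<theta>2 by (intro mult_mono) auto
          also have "\<dots> = \<theta>\<^sup>2 * \<eta>\<^sup>2 / 2 * (\<epsilon> / 2)\<^sup>2 - 8 * \<theta> * n" by (simp add: power2_eq_square algebra_simps)
          also have "\<dots> \<le> \<theta>\<^sup>2 * \<eta>\<^sup>2 / 2 * a\<^sup>2 - 8 * \<theta> * n"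
            using mult_left_mono[OF \<open>(\<epsilon> / 2)\<^sup>2 \<le> a\<^sup>2\<close>, of "\<theta>\<^sup>2 * \<eta>\<^sup>2 / 2"] by simp
          finally have "2 \<le> \<theta>\<^sup>2 * \<eta>\<^sup>2 / 2 * a\<^sup>2 - 8 * \<theta> * n" by simp
          moreover have "g \<sigma>1 \<omega> + g \<sigma>2 \<omega> = (\<theta>\<^sup>2 * \<eta>\<^sup>2 / 2 * a\<^sup>2 - 8 * \<theta> * n - 1) * h"
            by (simp add: g_def a_def[symmetric] \<sigma>1_def \<sigma>2_def power2_eq_square field_simps)
          ultimately have "1 * h \<le> g \<sigma>1 \<omega> + g \<sigma>2 \<omega>"
            using h by (simp only:) (intro mult_right_mono, auto)
          then have "\<phi> * h \<le> \<Phi> k \<omega> * (g \<sigma>1 \<omega> + g \<sigma>2 \<omega>)"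
            using \<phi> \<Phi>01[of k \<omega>] h by (intro mult_mono) auto
          then show ?thesis using True by (simp add: H_def distrib_left)
        qed (simp add: H_def)
      qed
    qed (use iS Hg in auto)
    \<comment> \<open>The two particles are joined by linearity of expectation alone; their joint
      conditional law never enters.\<close>
    also have "\<dots> \<le> expectation (\<lambda>\<omega>. H \<omega> * f1 (Z k \<omega>) (XX (s + h) \<omega>) + H \<omega> * f2 (Z k \<omega>) (YY (s + h) \<omega>))"
      using Hg fr1 fr2 by simp
    also have "\<dots> \<le> expectation (\<lambda>\<omega>. indicator (S k) \<omega> * \<Phi> (Suc k) \<omega> - indicator (S k) \<omega> * \<Phi> k \<omega>)"
    proof (rule integral_mono_AE)
      show "AE \<omega> in N. H \<omega> * f1 (Z k \<omega>) (XX (s + h) \<omega>) + H \<omega> * f2 (Z k \<omega>) (YY (s + h) \<omega>)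
          \<le> indicator (S k) \<omega> * \<Phi> (Suc k) \<omega> - indicator (S k) \<omega> * \<Phi> k \<omega>"
        using Zk shc
      proof eventually_elim
        case (elim \<omega>)
        define p where "p = Z k \<omega>"
        define a b where "a = XX (s + h) \<omega> - fst p" and "b = YY (s + h) \<omega> - snd p"
        define \<Delta> where "\<Delta> = a - (1 + \<eta>) *\<^sub>R b"
        have p: "p \<in> closure D \<times> closure D" using elim by (simp add: p_def)
        have nf: "norm (fst p) \<le> R" "norm (snd p) \<le> R" "norm (XX (s + h) \<omega>) \<le> R" "norm (YY (s + h) \<omega>) \<le> R"
          using p elim Rc by auto
        have na: "norm a \<le> 2 * R" "norm b \<le> 2 * R"
          unfolding a_def b_def using nf norm_triangle_ineq4[of "XX (s + h) \<omega>" "fst p"] norm_triangle_ineq4[of "YY (s + h) \<omega>" "snd p"] by linarith+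
        have "norm \<Delta> \<le> norm a + (1 + \<eta>) * norm b"
          unfolding \<Delta>_def using norm_triangle_ineq4[of a "(1 + \<eta>) *\<^sub>R b"] \<eta>0 by simp
        also have "\<dots> \<le> 2 * R + 2 * (2 * R)" using na \<eta>0 \<eta>1 by (intro add_mono mult_mono) auto
        finally have \<Delta>: "norm \<Delta> \<le> 6 * R" by simp
        have "f1 p (XX (s + h) \<omega>) + f2 p (YY (s + h) \<omega>) \<le> exp (- \<theta> * (w p \<bullet> \<Delta> + (norm \<Delta>)\<^sup>2 / 2)) - 1"
          using exp_pursuit_increment_ge[OF wfs(1)[OF p] \<Delta>[unfolded \<Delta>_def] _ \<eta>1 _ Q_def] \<eta>0 \<theta>1
          by (simp add: f1_def f2_def a_def b_def \<sigma>1_def \<sigma>2_def \<Delta>_def)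
        then have "\<Phi> k \<omega> * (f1 p (XX (s + h) \<omega>) + f2 p (YY (s + h) \<omega>))
            \<le> \<Phi> k \<omega> * (exp (- \<theta> * (w p \<bullet> \<Delta> + (norm \<Delta>)\<^sup>2 / 2)) - 1)"
          using \<Phi>01 by (intro mult_left_mono) auto
        \<comment> \<open>Linearity of \<open>w\<close> gives the new value
          \<open>w p + \<Delta>\<close>, and expanding its squared norm makes the change of exponent
          exact.\<close>
        also have "\<dots> = \<Phi> (Suc k) \<omega> - \<Phi> k \<omega>"
        proof -
          have "w (Z (Suc k) \<omega>) = w p + \<Delta>"
            unfolding Z_def sh by (simp add: w_def \<Delta>_def a_def b_def algebra_simps)
          then have "(norm (w (Z (Suc k) \<omega>)))\<^sup>2 = (norm (w p))\<^sup>2 + 2 * (w p \<bullet> \<Delta>) + (norm \<Delta>)\<^sup>2"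
            by (simp add: power2_norm_eq_inner inner_add_left inner_add_right inner_commute)
          then have "- \<theta> * (norm (w (Z (Suc k) \<omega>)))\<^sup>2 / 2
              = - \<theta> * (norm (w p))\<^sup>2 / 2 + - \<theta> * (w p \<bullet> \<Delta> + (norm \<Delta>)\<^sup>2 / 2)" by (simp add: field_simps)
          then have "\<Phi> (Suc k) \<omega> = \<Phi> k \<omega> * exp (- \<theta> * (w p \<bullet> \<Delta> + (norm \<Delta>)\<^sup>2 / 2))"
            unfolding \<Phi>_def p_def[symmetric] by (simp only: exp_add)
          then show ?thesis by (simp add: right_diff_distrib)
        qed
        finally show ?case by (auto simp: H_def p_def indicator_def distrib_left)
      qed
    qed (use fr1(1) fr2(1) i\<Phi> in auto)
    also have "\<dots> = expectation (\<lambda>\<omega>. indicator (S k) \<omega> * \<Phi> (Suc k) \<omega>) - expectation (\<lambda>\<omega>. indicator (S k) \<omega> * \<Phi> k \<omega>)"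
      using i\<Phi> by simp
    finally show ?thesis by simp
  qed
  have "prob (\<Inter>k. S k) = 0"
  proof (rule decreasing_events_null_of_drift[where \<Phi> = \<Phi> and \<theta> = "\<phi> * h"])
    show "S (Suc k) \<subseteq> S k" for k unfolding S_def by auto
    show "0 < \<phi> * h" using h by (simp add: \<phi>_def)
  qed (use \<Phi>01 drift in auto)
  then have "(\<Inter>k. S k) \<in> null_sets N" by (auto simp: null_sets_def emeasure_eq_measure)
  then have "AE \<omega> in N. \<omega> \<notin> (\<Inter>k. S k)" by (rule AE_not_in)
  then have "AE \<omega> in N. \<exists>t\<ge>0. norm (XX t \<omega> - YY t \<omega>) \<le> \<epsilon>"
    using AE_space
  proof eventually_elim
    case (elim \<omega>)
    then obtain j :: nat where "norm (XX (real j * h) \<omega> - YY (real j * h) \<omega>) \<le> \<epsilon>" unfolding S_def by (auto simp: not_less)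
    then show ?case using h by (intro exI[of _ "real j * h"]) simp
  qed
  then show ?thesis unfolding N_def XX_def YY_def .
qed

end
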